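(* Let $N\ge1$ and let $a=(a^1,a^2)$ be a pair of matrices on $I_N$. Then $a$ is a finite Hankel pair of size $N$, i.e. there is a finite Hankel vector moment sequence $(\{\alpha_n\}_{n\in I_N},Y,A)$ of size $N$ such that $$a^1_{m,n}=\langle Y\alpha_n,\alpha_m\rangle,\qquad a^2_{m,n}=\langle(1-Y)\alpha_n,\alpha_m\rangle\qquad\text{for all } m,n\in I_N,$$ if and only if the following four conditions hold: (1) $a^1$ and $a^2$ are positive semi-definite; (2) $a^1_{m+e_1,n}+a^2_{m+e_2,n}=a^1_{m,n+e_1}+a^2_{m,n+e_2}$ whenever $m,n\in I_{N-1}$; (3) $a^1_{(0,l),(0,l)}=a^2_{(l,0),(l,0)}=0$ for $l=1,\dots,N$; (4) for every $f:I_N\to\mathbb C$ with $\operatorname{supp}(f)\subseteq I_{N-1}$, if $(a^1+a^2)f=0$ then $(a^1S_1+a^2S_2)f=0$.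
   Context: For a pair $n=(n_1,n_2)$ of non-negative integers, $|n|=n_1+n_2$; $e_1=(1,0)$, $e_2=(0,1)$; $I_N=\{n:1\le|n|\le N\}$ (so $I_0=\emptyset$). Inner products are linear in the first entry. A matrix on a finite set $X$ is an array $[a_{x,y}]_{x,y\in X}$ of complex scalars; it acts on functions $f:X\to\mathbb C$ by $(af)(x)=\sum_{y}a_{x,y}f(y)$. It is positive semi-definite if $\sum_{i,j}a_{x_i,x_j}c_j\overline{c_i}\ge0$ for all finite choices of $x_i\in X$, $c_i\in\mathbb C$. $\operatorname{supp}(f)=\{x:f(x)\ne0\}$; functions on $I_{N-1}$ are identified with functions on $I_N$ supported in $I_{N-1}$. For $r=1,2$ the shift $S_r:\ell^2(I_{N-1})\to\ell^2(I_N)$ is $(S_rf)(n)=f(n-e_r)$ if $n-e_r\in I_{N-1}$ and $(S_rf)(n)=0$ otherwise. A positive contraction is a bounded self-adjoint operator $Y$ with $0\le Y\le1$. A symmetric operator $A$ on a Hilbert space $\mathcal H$ is a linear operator defined on a linear subspace $\mathrm{Dom}(A)$ with $\langle Ax,y\rangle=\langle x,Ay\rangle$ for $x,y\in\mathrm{Dom}(A)$. A finite Hankel vector moment sequence (HVMS) of size $N$ is a triple $(\{\alpha_n\}_{n\in I_N},Y,A)$ where $\{\alpha_n\}_{n\in I_N}$ are vectors in some Hilbert space $\mathcal H$; $Y$ is a positive contraction on $\mathcal H$ with $Y\alpha_{(0,l)}=0$ and $(1-Y)\alpha_{(l,0)}=0$ for $l=1,\dots,N$; $A$ is a (partially defined)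 symmetric operator on $\mathcal H$; and, if $N\ge2$, $\alpha_n\in\mathrm{Dom}(A)$ and $A\alpha_n=Y\alpha_{n+e_1}+(1-Y)\alpha_{n+e_2}$ for every $n\in I_{N-1}$. *)

theory Defs
  imports "HOL-Analysis.Analysis" "HOL-Algebra.Algebraic_Closure_Type"
begin

section \<open>Complex Hilbert spaces on an explicit carrier\<close>

text \<open>
  Hilbert spaces have to be quantified existentially inside a formula, so they are modelled by
  carrier sets rather than by a type class. The underlying complex vector space is a HOL-Algebra
  module over the field of complex numbers, which is available in the library as
  \<open>ring_of_type_algebra :: complex ring\<close>. (The module record also has fields for a
  multiplication and a unit of the carrier; \<open>module\<close> puts no condition on them.)
\<close>

record 'h hilbert_record = "(complex, 'h) module" +
  hinner :: "'h \<Rightarrow> 'h \<Rightarrow> complex"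

definition hnorm :: "('h, 'm) hilbert_record_scheme \<Rightarrow> 'h \<Rightarrow> real" where
  "hnorm H x = sqrt (Re (hinner H x x))"

text \<open>The value outside the carrier only serves to make this a \<open>Metric_space\<close>,
  whose axioms include symmetry and non-negativity off the carrier.\<close>

definition hdist :: "('h, 'm) hilbert_record_scheme \<Rightarrow> 'h \<Rightarrow> 'h \<Rightarrow> real" where
  "hdist H x y =
     (if x \<in> carrier H \<and> y \<in> carrier H then hnorm H (x \<ominus>\<^bsub>H\<^esub> y) else 0)"

locale complex_hilbert_space =
  module "ring_of_type_algebra :: complex ring" H
  for H :: "('h, 'm) hilbert_record_scheme" (structure) +
  assumes hinner_add_left:
      "\<lbrakk>x \<in> carrier H; y \<in> carrier H; z \<in> carrier H\<rbrakk> \<Longrightarrow>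
       hinner H (x \<oplus>\<^bsub>H\<^esub> y) z = hinner H x z + hinner H y z"
    and hinner_smult_left:
      "\<lbrakk>x \<in> carrier H; y \<in> carrier H\<rbrakk> \<Longrightarrow>
       hinner H (c \<odot>\<^bsub>H\<^esub> x) y = c * hinner H x y"
    and hinner_cnj_commute:
      "\<lbrakk>x \<in> carrier H; y \<in> carrier H\<rbrakk> \<Longrightarrow> hinner H y x = cnj (hinner H x y)"
    and hinner_nonneg:
      "x \<in> carrier H \<Longrightarrow> hinner H x x \<in> \<real>\<^sub>\<ge>\<^sub>0"
    and hinner_definite:
      "\<lbrakk>x \<in> carrier H; hinner H x x = 0\<rbrakk> \<Longrightarrow> x = \<zero>\<^bsub>H\<^esub>"
    and hcomplete: "Metric_space.mcomplete (carrier H) (hdist H)"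

section \<open>Operators\<close>

definition linear_operator_on ::
    "('h, 'm) hilbert_record_scheme \<Rightarrow> 'h set \<Rightarrow> ('h \<Rightarrow> 'h) \<Rightarrow> bool" where
  "linear_operator_on H D T \<longleftrightarrow>
     submodule D (ring_of_type_algebra :: complex ring) H \<and>
     (\<forall>x\<in>D. T x \<in> carrier H) \<and>
     (\<forall>x\<in>D. \<forall>y\<in>D. T (x \<oplus>\<^bsub>H\<^esub> y) = T x \<oplus>\<^bsub>H\<^esub> T y) \<and>
     (\<forall>c. \<forall>x\<in>D. T (c \<odot>\<^bsub>H\<^esub> x) = c \<odot>\<^bsub>H\<^esub> T x)"

text \<open>A symmetric operator is a pair of its domain \<open>D\<close> and its action \<open>A\<close>; the domain
  need be neither dense nor closed.\<close>

definition symmetric_operator ::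
    "('h, 'm) hilbert_record_scheme \<Rightarrow> 'h set \<Rightarrow> ('h \<Rightarrow> 'h) \<Rightarrow> bool" where
  "symmetric_operator H D A \<longleftrightarrow>
     linear_operator_on H D A \<and>
     (\<forall>x\<in>D. \<forall>y\<in>D. hinner H (A x) y = hinner H x (A y))"

definition bounded_operator ::
    "('h, 'm) hilbert_record_scheme \<Rightarrow> ('h \<Rightarrow> 'h) \<Rightarrow> bool" where
  "bounded_operator H T \<longleftrightarrow>
     linear_operator_on H (carrier H) T \<and>
     (\<exists>K. \<forall>x\<in>carrier H. hnorm H (T x) \<le> K * hnorm H x)"

definition self_adjoint ::
    "('h, 'm) hilbert_record_scheme \<Rightarrow> ('h \<Rightarrow> 'h) \<Rightarrow> bool" where
  "self_adjoint H T \<longleftrightarrow>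
     (\<forall>x\<in>carrier H. \<forall>y\<in>carrier H. hinner H (T x) y = hinner H x (T y))"

definition positive_contraction ::
    "('h, 'm) hilbert_record_scheme \<Rightarrow> ('h \<Rightarrow> 'h) \<Rightarrow> bool" where
  "positive_contraction H Y \<longleftrightarrow>
     bounded_operator H Y \<and> self_adjoint H Y \<and>
     (\<forall>x\<in>carrier H. hinner H (Y x) x \<in> \<real>\<^sub>\<ge>\<^sub>0) \<and>
     (\<forall>x\<in>carrier H. hinner H (x \<ominus>\<^bsub>H\<^esub> Y x) x \<in> \<real>\<^sub>\<ge>\<^sub>0)"

section \<open>Hankel vector moment sequences and Hankel pairs\<close>

definition e1 :: "nat \<times> nat" where "e1 = (1, 0)"
definition e2 :: "nat \<times> nat" where "e2 = (0, 1)"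

definition index_set :: "nat \<Rightarrow> (nat \<times> nat) set" where
  "index_set N = {n. 1 \<le> fst n + snd n \<and> fst n + snd n \<le> N}"

definition finite_HVMS ::
    "('h, 'm) hilbert_record_scheme \<Rightarrow> nat \<Rightarrow> (nat \<times> nat \<Rightarrow> 'h) \<Rightarrow>
     ('h \<Rightarrow> 'h) \<Rightarrow> 'h set \<Rightarrow> ('h \<Rightarrow> 'h) \<Rightarrow> bool" where
  "finite_HVMS H N \<alpha> Y D A \<longleftrightarrow>
     complex_hilbert_space H \<and>
     (\<forall>n\<in>index_set N. \<alpha> n \<in> carrier H) \<and>
     positive_contraction H Y \<and>
     (\<forall>l\<in>{1..N}. Y (\<alpha> (0, l)) = \<zero>\<^bsub>H\<^esub>) \<and>
     (\<forall>l\<in>{1..N}. \<alpha> (l, 0) \<ominus>\<^bsub>H\<^esub> Y (\<alpha> (l, 0)) = \<zero>\<^bsub>H\<^esub>) \<and>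
     symmetric_operator H D A \<and>
     (2 \<le> N \<longrightarrow>
       (\<forall>n\<in>index_set (N - 1).
          \<alpha> n \<in> D \<and>
          A (\<alpha> n) = Y (\<alpha> (n + e1)) \<oplus>\<^bsub>H\<^esub> (\<alpha> (n + e2) \<ominus>\<^bsub>H\<^esub> Y (\<alpha> (n + e2)))))"

text \<open>The type argument is the ambient type of the carriers of the Hilbert spaces
  being quantified over.\<close>

definition finite_Hankel_pair ::
    "'h itself \<Rightarrow> nat \<Rightarrow> (nat \<times> nat \<Rightarrow> nat \<times> nat \<Rightarrow> complex) \<Rightarrow>
     (nat \<times> nat \<Rightarrow> nat \<times> nat \<Rightarrow> complex) \<Rightarrow> bool" where
  "finite_Hankel_pair TYPE('h) N a1 a2 \<longleftrightarrow>
     (\<exists>(H :: 'h hilbert_record) \<alpha> Y D A.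
        finite_HVMS H N \<alpha> Y D A \<and>
        (\<forall>m\<in>index_set N. \<forall>n\<in>index_set N.
           a1 m n = hinner H (Y (\<alpha> n)) (\<alpha> m) \<and>
           a2 m n = hinner H (\<alpha> n \<ominus>\<^bsub>H\<^esub> Y (\<alpha> n)) (\<alpha> m)))"

section \<open>Matrices on a finite set\<close>

text \<open>Matrices on \<open>S\<close> and functions on \<open>S\<close> are total functions of which only the values
  on \<open>S\<close> are used.\<close>

definition matrix_apply ::
    "'x set \<Rightarrow> ('x \<Rightarrow> 'x \<Rightarrow> complex) \<Rightarrow> ('x \<Rightarrow> complex) \<Rightarrow> 'x \<Rightarrow> complex" where
  "matrix_apply S a f x = (\<Sum>y\<in>S. a x y * f y)"

definition positive_semidefinite ::
    "'x set \<Rightarrow> ('x \<Rightarrow> 'x \<Rightarrow> complex) \<Rightarrow> bool" where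
  "positive_semidefinite S a \<longleftrightarrow>
     (\<forall>(k :: nat) x c. (\<forall>i<k. x i \<in> S) \<longrightarrow>
        (\<Sum>i<k. \<Sum>j<k. a (x i) (x j) * c j * cnj (c i)) \<in> \<real>\<^sub>\<ge>\<^sub>0)"

definition supp_on :: "'x set \<Rightarrow> ('x \<Rightarrow> complex) \<Rightarrow> 'x set" where
  "supp_on S f = {x \<in> S. f x \<noteq> 0}"

text \<open>\<open>shift N e1\<close> and \<open>shift N e2\<close> are the two shifts from functions on
  \<open>index_set (N - 1)\<close> to functions on \<open>index_set N\<close>. Since subtraction of natural numbers
  truncates, the side condition is expressed without it.\<close>

definition shift ::
    "nat \<Rightarrow> nat \<times> nat \<Rightarrow> (nat \<times> nat \<Rightarrow> complex) \<Rightarrow> nat \<times> nat \<Rightarrow> complex" where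
  "shift N e f n = (if \<exists>k\<in>index_set (N - 1). n = k + e then f (n - e) else 0)"

end

theory Submission
  imports Defs
begin

text \<open>
  If the pair comes from a Hankel vector moment sequence, its entries are inner products
  \<open>\<langle>T \<alpha>\<^sub>n, \<alpha>\<^sub>m\<rangle>\<close> with \<open>T = Y\<close> or \<open>T = 1 - Y\<close>. Positivity of \<open>T\<close> makes both matrices positive
  semi-definite, symmetry of \<open>A\<close> is the Hankel identity, and a vanishing combination
  \<open>\<Sum> f\<^sub>n \<alpha>\<^sub>n\<close> is sent by \<open>A\<close> to \<open>0\<close>, which is the kernel condition
  (lemma \<open>Hankel_pair_conditions\<close>).

  For the converse let \<open>a = a1 + a2\<close>. The Hilbert space is the quotient of the functions on
  the index set by the null space of the form of \<open>a\<close>, with \<open>\<alpha>\<^sub>n\<close> the class of the point mass at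
  \<open>n\<close>. As \<open>0 \<le> a1 \<le> a\<close>, the form of \<open>a1\<close> descends to this quotient and is
  \<open>\<langle>Y x, y\<rangle>\<close> for a positive contraction \<open>Y\<close>; likewise \<open>a2\<close> is represented by \<open>1 - Y\<close>. The
  vectors \<open>\<alpha>\<^sub>n\<close> span the space, so a vector is determined by its inner products with them.
  This is why the kernel condition, which tests only against the \<open>\<alpha>\<^sub>m\<close>, is enough to make
  \<open>A (\<Sum> f\<^sub>n \<alpha>\<^sub>n) = \<Sum> f\<^sub>n (Y \<alpha>\<^bsub>n+e1\<^esub> + (1 - Y) \<alpha>\<^bsub>n+e2\<^esub>)\<close> well defined. A dilation with
  \<open>Y\<close> a projection would not do, since there the \<open>\<alpha>\<^sub>n\<close> need not span.

  Quotients are avoided by choosing functions \<open>u\<^sub>0, \<dots>, u\<^bsub>k-1\<^esub>\<close> that are orthonormal for the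
  form of \<open>a\<close> and span modulo its null space (lemma \<open>orthonormal_expansion\<close>). For each of the
  three matrices \<open>b\<close>, let \<open>coords b f\<close> be the tuple of the numbers \<open>b(f, u\<^sub>i)\<close>. In these
  terms the class of \<open>f\<close> is \<open>coords a f\<close>, the operator \<open>Y\<close> sends it to \<open>coords a1 f\<close>, the
  operator \<open>1 - Y\<close> sends it to \<open>coords a2 f\<close>, and \<open>A\<close> sends it to
  \<open>coords a1 (S\<^sub>1 f) + coords a2 (S\<^sub>2 f)\<close>. Everything takes place in \<open>k\<close>-dimensional coordinate
  space, which injects into any type that contains a copy of the complex numbers.
\<close>

section \<open>The sesquilinear form of a matrix\<close>

definition sesq ::
    "'x set \<Rightarrow> ('x \<Rightarrow> 'x \<Rightarrow> complex) \<Rightarrow> ('x \<Rightarrow> complex) \<Rightarrow> ('x \<Rightarrow> complex) \<Rightarrow> complex" where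
  "sesq S a f g = (\<Sum>x\<in>S. \<Sum>y\<in>S. a x y * f y * cnj (g x))"

definition point_mass :: "'x \<Rightarrow> 'x \<Rightarrow> complex" where
  "point_mass n x = (if x = n then 1 else 0)"

lemma sesq_add_left: "sesq S a (\<lambda>x. f x + g x) h = sesq S a f h + sesq S a g h"
  by (simp add: sesq_def algebra_simps sum.distrib)

lemma sesq_add_right: "sesq S a h (\<lambda>x. f x + g x) = sesq S a h f + sesq S a h g"
  by (simp add: sesq_def algebra_simps sum.distrib)

lemma sesq_diff_left: "sesq S a (\<lambda>x. f x - g x) h = sesq S a f h - sesq S a g h"
  by (simp add: sesq_def algebra_simps sum_subtractf)

lemma sesq_scale_left: "sesq S a (\<lambda>x. c * f x) h = c * sesq S a f h"
  by (simp add: sesq_def algebra_simps sum_distrib_left)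

lemma sesq_scale_right: "sesq S a h (\<lambda>x. c * f x) = cnj c * sesq S a h f"
  by (simp add: sesq_def algebra_simps sum_distrib_left)

lemma sesq_zero_left: "sesq S a (\<lambda>x. 0) h = 0"
  by (simp add: sesq_def)

lemma sesq_sum_left:
  "sesq S a (\<lambda>x. \<Sum>i\<in>I. c i * u i x) h = (\<Sum>i\<in>I. c i * sesq S a (u i) h)"
proof (induction I rule: infinite_finite_induct)
  case (insert i I)
  then show ?case
    using sesq_add_left[of S a "\<lambda>x. c i * u i x" "\<lambda>x. \<Sum>i\<in>I. c i * u i x" h]
    by (simp add: sesq_scale_left)
qed (simp_all add: sesq_zero_left)

lemma sesq_add_matrix:
  "sesq S (\<lambda>x y. a x y + b x y) f g = sesq S a f g + sesq S b f g"
  by (simp add: sesq_def algebra_simps sum.distrib)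

lemma sesq_cong:
  assumes "\<And>x. x \<in> S \<Longrightarrow> f x = f' x" "\<And>x. x \<in> S \<Longrightarrow> g x = g' x"
  shows "sesq S a f g = sesq S a f' g'"
  using assms by (simp add: sesq_def cong: sum.cong)

lemma sesq_point_mass_right:
  assumes "finite S" "m \<in> S"
  shows "sesq S a f (point_mass m) = matrix_apply S a f m"
proof -
  have "sesq S a f (point_mass m) = (\<Sum>x\<in>S. if x = m then \<Sum>y\<in>S. a x y * f y else 0)"
    unfolding sesq_def by (intro sum.cong) (auto simp: point_mass_def)
  then show ?thesis
    using assms by (simp add: matrix_apply_def)
qed

lemma matrix_apply_point_mass:
  assumes "finite S" "n \<in> S"
  shows "matrix_apply S a (point_mass n) m = a m n"
proof -
  have "matrix_apply S a (point_mass n) m = (\<Sum>y\<in>S. if y = n then a m y else 0)"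
    unfolding matrix_apply_def by (intro sum.cong) (auto simp: point_mass_def)
  then show ?thesis
    using assms by simp
qed

lemma sesq_eq_sum_matrix_apply: "sesq S a f g = (\<Sum>m\<in>S. matrix_apply S a f m * cnj (g m))"
  by (simp add: sesq_def matrix_apply_def sum_distrib_right)

locale psd_matrix =
  fixes S :: "'x set" and a :: "'x \<Rightarrow> 'x \<Rightarrow> complex"
  assumes finite_S: "finite S" and psd: "positive_semidefinite S a"
begin

lemma sesq_nonneg: "sesq S a f f \<in> \<real>\<^sub>\<ge>\<^sub>0"
proof -
  obtain x where x: "bij_betw x {..<card S} S"
    using ex_bij_betw_nat_finite[OF finite_S] by (auto simp: atLeast0LessThan)
  have "(\<Sum>i<card S. \<Sum>j<card S. a (x i) (x j) * f (x j) * cnj (f (x i))) = sesq S a f f"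
    unfolding sesq_def
    by (subst sum.reindex_bij_betw[OF x, symmetric])
      (simp add: sum.reindex_bij_betw[OF x, where g = "\<lambda>y. a _ y * f y * cnj (f _)"])
  moreover have "\<forall>i<card S. x i \<in> S"
    using x by (auto simp: bij_betw_def)
  ultimately show ?thesis
    using psd[unfolded positive_semidefinite_def, rule_format, of "card S" x "\<lambda>i. f (x i)"]
    by simp
qed

lemma Re_sesq_nonneg: "0 \<le> Re (sesq S a f f)"
  using sesq_nonneg[of f] by (auto simp: complex_nonneg_Reals_iff)

lemma Im_sesq_self: "Im (sesq S a f f) = 0"
  using sesq_nonneg[of f] by (auto simp: complex_nonneg_Reals_iff)

lemma sesq_hermitian: "sesq S a g f = cnj (sesq S a f g)"
proof (rule complex_eqI)
  \<comment> \<open>Polarization: the form is real at \<open>f + \<i> g\<close> and at \<open>f + g\<close>.\<close>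
  have "Im (sesq S a (\<lambda>x. f x + \<i> * g x) (\<lambda>x. f x + \<i> * g x)) = 0"
    by (rule Im_sesq_self)
  then show "Re (sesq S a g f) = Re (cnj (sesq S a f g))"
    by (simp add: sesq_add_left sesq_add_right sesq_scale_left sesq_scale_right Im_sesq_self)
  have "Im (sesq S a (\<lambda>x. f x + g x) (\<lambda>x. f x + g x)) = 0"
    by (rule Im_sesq_self)
  then show "Im (sesq S a g f) = Im (cnj (sesq S a f g))"
    by (simp add: sesq_add_left sesq_add_right Im_sesq_self)
qed

text \<open>
  If the form vanishes at \<open>(f, f)\<close> but is \<open>B \<noteq> 0\<close> at \<open>(f, g)\<close>, then its value at
  \<open>(g + c f, g + c f)\<close> is \<open>a(g, g) + 2 Re (c B)\<close>, which is unbounded below as \<open>c\<close> runs through the negative multiples of the conjugate of \<open>B\<close>.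
\<close>

lemma sesq_null:
  assumes "sesq S a f f = 0"
  shows "sesq S a f g = 0"
proof (rule ccontr)
  define B where "B = sesq S a f g"
  assume "sesq S a f g \<noteq> 0"
  then have pos: "0 < (cmod B)\<^sup>2"
    by (simp add: B_def)
  \<comment> \<open>This scale makes the value at \<open>g + c f\<close> equal to \<open>-1\<close>.\<close>
  define t where "t = (Re (sesq S a g g) + 1) / (2 * (cmod B)\<^sup>2)"
  define c where "c = - complex_of_real t * cnj B"
  have "Re (sesq S a (\<lambda>x. g x + c * f x) (\<lambda>x. g x + c * f x)) = Re (sesq S a g g) + 2 * Re (c * B)"
    by (simp add: sesq_add_left sesq_add_right sesq_scale_left sesq_scale_right assms
        sesq_hermitian[of g f] B_def)
  moreover have "Re (c * B) = - t * (cmod B)\<^sup>2"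
    unfolding cmod_power2 by (simp add: c_def power2_eq_square algebra_simps)
  moreover have "2 * (t * (cmod B)\<^sup>2) = Re (sesq S a g g) + 1"
    using pos by (simp add: t_def)
  ultimately show False
    using Re_sesq_nonneg[of "\<lambda>x. g x + c * f x"] by simp
qed

text \<open>
  Gram--Schmidt modulo the null space, adding one point mass at a time. The residual \<open>w\<close> of a new
  point mass is either null, and then it is invisible to the form, or it is normalized and
  added to the orthonormal system.
\<close>

lemma orthonormal_expansion_on:
  assumes "F \<subseteq> S"
  shows "\<exists>(k::nat) u. (\<forall>i<k. \<forall>j<k. sesq S a (u i) (u j) = (if i = j then 1 else 0)) \<and>
    (\<forall>z\<in>F. \<exists>c. \<forall>h. sesq S a (point_mass z) h = (\<Sum>i<k. c i * sesq S a (u i) h))"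
  using finite_subset[OF assms finite_S] assms
proof (induction F)
  case empty
  then show ?case by (intro exI[of _ 0]) simp
next
  case (insert z F)
  then obtain k :: nat and u where
    on': "\<forall>i<k. \<forall>j<k. sesq S a (u i) (u j) = (if i = j then 1 else 0)" and
    ex: "\<forall>z\<in>F. \<exists>c. \<forall>h. sesq S a (point_mass z) h = (\<Sum>i<k. c i * sesq S a (u i) h)"
    by auto
  note on = on'[rule_format]
  define d where "d i = sesq S a (point_mass z) (u i)" for i
  define w where "w x = point_mass z x - (\<Sum>i<k. d i * u i x)" for x
  have w: "sesq S a w h = sesq S a (point_mass z) h - (\<Sum>i<k. d i * sesq S a (u i) h)" for h
    unfolding w_def by (simp add: sesq_diff_left sesq_sum_left)
  have orth: "sesq S a w (u j) = 0" if "j < k" for j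
  proof -
    have "(\<Sum>i<k. d i * sesq S a (u i) (u j)) = (\<Sum>i<k. if i = j then d i else 0)"
      using that by (intro sum.cong) (auto simp: on)
    then show ?thesis
      using that by (simp add: w d_def)
  qed
  show ?case
  proof (cases "sesq S a w w = 0")
    case True
    then have "sesq S a (point_mass z) h = (\<Sum>i<k. d i * sesq S a (u i) h)" for h
      using sesq_null[OF True, of h] by (simp add: w)
    then show ?thesis
      using on ex by (intro exI[of _ k] exI[of _ u]) auto
  next
    case False
    define r where "r = sqrt (Re (sesq S a w w))"
    have ww: "sesq S a w w = complex_of_real (Re (sesq S a w w))"
      by (simp add: complex_eq_iff Im_sesq_self)
    have "r \<noteq> 0"
      using False ww by (auto simp: r_def)
    have rr: "complex_of_real r * complex_of_real r = sesq S a w w"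
      using Re_sesq_nonneg[of w] ww by (metis of_real_mult r_def real_sqrt_mult_self abs_of_nonneg)
    define s where "s = 1 / complex_of_real r"
    define v where "v = u(k := (\<lambda>x. s * w x))"
    have vk: "sesq S a (v k) h = s * sesq S a w h"
      and vk': "sesq S a h (v k) = s * sesq S a h w" for h
      by (simp_all add: v_def sesq_scale_left sesq_scale_right) (simp add: s_def)
    have vi: "v i = u i" if "i < k" for i
      using that by (simp add: v_def)
    have "sesq S a (v i) (v j) = (if i = j then 1 else 0)" if ij: "i < Suc k" "j < Suc k" for i j
    proof -
      consider "i < k" "j < k" | "i < k" "j = k" | "i = k" "j < k" | "i = k" "j = k"
        using ij by (auto simp: less_Suc_eq)
      then show ?thesis
      proof cases
        case 2
        then show ?thesis
          using orth[of i] by (simp add: vi vk' sesq_hermitian[of "u i" w])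
      next
        case 4
        then show ?thesis
          using \<open>r \<noteq> 0\<close> by (simp add: vk vk' s_def flip: rr)
      qed (use orth in \<open>auto simp: vi vk on\<close>)
    qed
    moreover have "\<exists>c. \<forall>h. sesq S a (point_mass y) h = (\<Sum>i<Suc k. c i * sesq S a (v i) h)"
      if y: "y \<in> insert z F" for y
    proof (cases "y = z")
      case True
      have "sesq S a (point_mass z) h = (\<Sum>i<Suc k. (d(k := r)) i * sesq S a (v i) h)" for h
        using \<open>r \<noteq> 0\<close> by (simp add: vi vk w s_def)
      then show ?thesis
        using True by blast
    next
      case False
      then obtain c where "\<forall>h. sesq S a (point_mass y) h = (\<Sum>i<k. c i * sesq S a (u i) h)"
        using ex y by auto
      then have "sesq S a (point_mass y) h = (\<Sum>i<Suc k. (c(k := 0)) i * sesq S a (v i) h)" for h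
        by (simp add: vi)
      then show ?thesis
        by blast
    qed
    ultimately show ?thesis
      by (intro exI[of _ "Suc k"] exI[of _ v]) auto
  qed
qed

text \<open>
  Every function on \<open>S\<close> is a combination of point masses, so the expansion of the point masses
  gives Parseval's identity for all functions.
\<close>

lemma orthonormal_expansion:
  obtains k :: nat and u where
    "\<And>i j. i < k \<Longrightarrow> j < k \<Longrightarrow> sesq S a (u i) (u j) = (if i = j then 1 else 0)"
    "\<And>f h. sesq S a f h = (\<Sum>i<k. sesq S a f (u i) * sesq S a (u i) h)"
proof -
  obtain k :: nat and u where
    on: "\<And>i j. i < k \<Longrightarrow> j < k \<Longrightarrow> sesq S a (u i) (u j) = (if i = j then 1 else 0)" and
    "\<forall>z\<in>S. \<exists>c. \<forall>h. sesq S a (point_mass z) h = (\<Sum>i<k. c i * sesq S a (u i) h)"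
    using orthonormal_expansion_on[of S] by auto
  then obtain c where
    c: "\<And>z h. z \<in> S \<Longrightarrow> sesq S a (point_mass z) h = (\<Sum>i<k. c z i * sesq S a (u i) h)"
    by metis
  have "sesq S a f h = (\<Sum>i<k. sesq S a f (u i) * sesq S a (u i) h)" for f h
  proof -
    define d where "d i = (\<Sum>z\<in>S. f z * c z i)" for i
    have exp: "sesq S a f g = (\<Sum>i<k. d i * sesq S a (u i) g)" for g
    proof -
      have "sesq S a f g = sesq S a (\<lambda>x. \<Sum>z\<in>S. f z * point_mass z x) g"
      proof (intro sesq_cong refl)
        fix x assume "x \<in> S"
        have "(\<Sum>z\<in>S. f z * point_mass z x) = (\<Sum>z\<in>S. if x = z then f z else 0)"
          by (intro sum.cong) (auto simp: point_mass_def)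
        then show "f x = (\<Sum>z\<in>S. f z * point_mass z x)"
          using \<open>x \<in> S\<close> finite_S by simp
      qed
      also have "\<dots> = (\<Sum>z\<in>S. \<Sum>i<k. f z * (c z i * sesq S a (u i) g))"
        by (simp add: sesq_sum_left c sum_distrib_left cong: sum.cong)
      also have "\<dots> = (\<Sum>i<k. d i * sesq S a (u i) g)"
        by (subst sum.swap) (simp add: d_def sum_distrib_right mult.assoc)
      finally show ?thesis .
    qed
    have "sesq S a f (u j) = d j" if "j < k" for j
    proof -
      have "sesq S a f (u j) = (\<Sum>i<k. if i = j then d i else 0)"
        unfolding exp using that by (intro sum.cong) (auto simp: on)
      then show ?thesis
        using that by simp
    qed
    then show ?thesis
      unfolding exp[of h] by simp
  qed
  then show thesis
    using that on by blast
qed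

end

section \<open>Operators on a Hilbert space with an explicit carrier\<close>

lemma ring_of_type_algebra_simps [simp]:
  "carrier (ring_of_type_algebra :: 'a::comm_ring_1 ring) = UNIV"
  "x \<oplus>\<^bsub>ring_of_type_algebra\<^esub> y = x + y"
  "x \<otimes>\<^bsub>ring_of_type_algebra\<^esub> y = x * y"
  "\<zero>\<^bsub>ring_of_type_algebra\<^esub> = 0"
  "\<one>\<^bsub>ring_of_type_algebra\<^esub> = 1"
  by (simp_all add: ring_of_type_algebra_def)

context complex_hilbert_space
begin

lemma smult_zero_left [simp]: "x \<in> carrier H \<Longrightarrow> 0 \<odot>\<^bsub>H\<^esub> x = \<zero>\<^bsub>H\<^esub>"
  using smult_l_null[of x] by simp

lemma hinner_zero_left [simp]: "x \<in> carrier H \<Longrightarrow> hinner H \<zero>\<^bsub>H\<^esub> x = 0"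
  using hinner_smult_left[of x x 0] by simp

lemma hinner_add_right:
  assumes "x \<in> carrier H" "y \<in> carrier H" "z \<in> carrier H"
  shows "hinner H z (x \<oplus>\<^bsub>H\<^esub> y) = hinner H z x + hinner H z y"
  using assms hinner_cnj_commute[of "x \<oplus>\<^bsub>H\<^esub> y" z] hinner_cnj_commute[of x z]
    hinner_cnj_commute[of y z] by (simp add: hinner_add_left)

lemma hinner_diff_left:
  assumes "x \<in> carrier H" "y \<in> carrier H" "z \<in> carrier H"
  shows "hinner H (x \<ominus>\<^bsub>H\<^esub> y) z = hinner H x z - hinner H y z"
proof -
  have "(x \<ominus>\<^bsub>H\<^esub> y) \<oplus>\<^bsub>H\<^esub> y = x"
    using assms by (simp add: a_minus_def M.a_assoc M.l_neg)
  then show ?thesis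
    using hinner_add_left[of "x \<ominus>\<^bsub>H\<^esub> y" y z] assms by simp
qed

lemma hinner_diff_right:
  assumes "x \<in> carrier H" "y \<in> carrier H" "z \<in> carrier H"
  shows "hinner H z (x \<ominus>\<^bsub>H\<^esub> y) = hinner H z x - hinner H z y"
  using assms hinner_cnj_commute[of "x \<ominus>\<^bsub>H\<^esub> y" z] hinner_cnj_commute[of x z]
    hinner_cnj_commute[of y z] by (simp add: hinner_diff_left)

lemma hinner_eqI:
  assumes "x \<in> carrier H" "y \<in> carrier H"
    and "\<And>z. z \<in> carrier H \<Longrightarrow> hinner H x z = hinner H y z"
  shows "x = y"
proof -
  have "x \<ominus>\<^bsub>H\<^esub> y = \<zero>\<^bsub>H\<^esub>"
    using assms by (intro hinner_definite) (auto simp: hinner_diff_left)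
  moreover have "(x \<ominus>\<^bsub>H\<^esub> y) \<oplus>\<^bsub>H\<^esub> y = x"
    using assms by (simp add: a_minus_def M.a_assoc M.l_neg)
  ultimately show ?thesis
    using assms by simp
qed

lemma lincomb_closed:
  "x \<in> I \<rightarrow> carrier H \<Longrightarrow> finsum H (\<lambda>i. c i \<odot>\<^bsub>H\<^esub> x i) I \<in> carrier H"
  by (rule M.finsum_closed) auto

lemma hinner_lincomb_left:
  assumes "finite I" "x \<in> I \<rightarrow> carrier H" "y \<in> carrier H"
  shows "hinner H (finsum H (\<lambda>i. c i \<odot>\<^bsub>H\<^esub> x i) I) y = (\<Sum>i\<in>I. c i * hinner H (x i) y)"
  using assms(1,2)
proof (induction I)
  case (insert i I)
  then have "(\<lambda>i. c i \<odot>\<^bsub>H\<^esub> x i) \<in> I \<rightarrow> carrier H" and "x i \<in> carrier H"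
    by auto
  then show ?case
    using insert assms(3)
    by (simp add: M.finsum_insert hinner_add_left hinner_smult_left M.finsum_closed)
qed (use assms(3) in simp)

lemma hinner_lincomb_right:
  assumes "finite I" "x \<in> I \<rightarrow> carrier H" "y \<in> carrier H"
  shows "hinner H y (finsum H (\<lambda>i. c i \<odot>\<^bsub>H\<^esub> x i) I) = (\<Sum>i\<in>I. cnj (c i) * hinner H y (x i))"
proof -
  have "cnj (hinner H (x i) y) = hinner H y (x i)" if "i \<in> I" for i
    using assms that by (metis Pi_mem hinner_cnj_commute)
  then show ?thesis
    using assms hinner_cnj_commute[of "finsum H (\<lambda>i. c i \<odot>\<^bsub>H\<^esub> x i) I" y]
    by (simp add: hinner_lincomb_left lincomb_closed)
qed

lemma linear_operator_on_zero:
  assumes "linear_operator_on H D T"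
  shows "\<zero>\<^bsub>H\<^esub> \<in> D" "T \<zero>\<^bsub>H\<^esub> = \<zero>\<^bsub>H\<^esub>"
proof -
  have sub: "submodule D (ring_of_type_algebra :: complex ring) H"
    and cl: "\<And>x. x \<in> D \<Longrightarrow> T x \<in> carrier H"
    and sc: "\<And>c x. x \<in> D \<Longrightarrow> T (c \<odot>\<^bsub>H\<^esub> x) = c \<odot>\<^bsub>H\<^esub> T x"
    using assms by (auto simp: linear_operator_on_def)
  obtain x where "x \<in> D" "x \<in> carrier H"
    using submoduleE(1,2)[OF sub] by blast
  then show z: "\<zero>\<^bsub>H\<^esub> \<in> D"
    using submoduleE(4)[OF sub, of 0 x] smult_zero_left[of x] by simp
  show "T \<zero>\<^bsub>H\<^esub> = \<zero>\<^bsub>H\<^esub>"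
    using sc[OF z, of 0] smult_zero_left[OF cl[OF z]] by simp
qed

lemma linear_operator_on_lincomb:
  assumes T: "linear_operator_on H D T" and "finite I" "x \<in> I \<rightarrow> D"
  shows "finsum H (\<lambda>i. c i \<odot>\<^bsub>H\<^esub> x i) I \<in> D \<and>
    T (finsum H (\<lambda>i. c i \<odot>\<^bsub>H\<^esub> x i) I) = finsum H (\<lambda>i. c i \<odot>\<^bsub>H\<^esub> T (x i)) I"
  using assms(2,3)
proof (induction I)
  case empty
  then show ?case
    using linear_operator_on_zero[OF T] by simp
next
  case (insert i I)
  have sub: "submodule D (ring_of_type_algebra :: complex ring) H"
    and cl: "\<And>x. x \<in> D \<Longrightarrow> T x \<in> carrier H"
    and ad: "\<And>x y. x \<in> D \<Longrightarrow> y \<in> D \<Longrightarrow> T (x \<oplus>\<^bsub>H\<^esub> y) = T x \<oplus>\<^bsub>H\<^esub> T y"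
    and sc: "\<And>c x. x \<in> D \<Longrightarrow> T (c \<odot>\<^bsub>H\<^esub> x) = c \<odot>\<^bsub>H\<^esub> T x"
    using T by (auto simp: linear_operator_on_def)
  have D: "D \<subseteq> carrier H" "\<And>c x. x \<in> D \<Longrightarrow> c \<odot>\<^bsub>H\<^esub> x \<in> D"
      "\<And>x y. x \<in> D \<Longrightarrow> y \<in> D \<Longrightarrow> x \<oplus>\<^bsub>H\<^esub> y \<in> D"
    using submoduleE[OF sub] by auto
  have x: "x i \<in> D" "\<And>j. j \<in> I \<Longrightarrow> x j \<in> D"
    using insert.prems by auto
  have "(\<lambda>i. c i \<odot>\<^bsub>H\<^esub> x i) \<in> I \<rightarrow> carrier H" "(\<lambda>i. c i \<odot>\<^bsub>H\<^esub> T (x i)) \<in> I \<rightarrow> carrier H"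
    using x subsetD[OF D(1)] cl by auto
  then show ?case
    using insert x D(1) cl by (simp add: M.finsum_insert D(2,3) ad sc subset_iff)
qed

lemma linear_operator_on_diff:
  assumes T: "linear_operator_on H (carrier H) T" and xy: "x \<in> carrier H" "y \<in> carrier H"
  shows "T (x \<ominus>\<^bsub>H\<^esub> y) = T x \<ominus>\<^bsub>H\<^esub> T y"
proof -
  have cl: "\<And>x. x \<in> carrier H \<Longrightarrow> T x \<in> carrier H"
    and ad: "\<And>x y. x \<in> carrier H \<Longrightarrow> y \<in> carrier H \<Longrightarrow> T (x \<oplus>\<^bsub>H\<^esub> y) = T x \<oplus>\<^bsub>H\<^esub> T y"
    using T by (auto simp: linear_operator_on_def)
  have "x = (x \<ominus>\<^bsub>H\<^esub> y) \<oplus>\<^bsub>H\<^esub> y"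
    using xy by (simp add: a_minus_def M.a_assoc M.l_neg)
  then have "T x = T (x \<ominus>\<^bsub>H\<^esub> y) \<oplus>\<^bsub>H\<^esub> T y"
    using ad[of "x \<ominus>\<^bsub>H\<^esub> y" y] xy by simp
  then show ?thesis
    using cl xy by (simp add: a_minus_def M.a_assoc M.r_neg)
qed

text \<open>
  Linearity is checked on inner products, which determine a vector (\<open>hinner_eqI\<close>); this avoids
  computing with differences in the module.
\<close>

lemma linear_operator_on_complement:
  assumes T: "linear_operator_on H (carrier H) T"
  shows "linear_operator_on H (carrier H) (\<lambda>x. x \<ominus>\<^bsub>H\<^esub> T x)"
proof -
  have cl: "\<And>x. x \<in> carrier H \<Longrightarrow> T x \<in> carrier H"
    and ad: "\<And>x y. x \<in> carrier H \<Longrightarrow> y \<in> carrier H \<Longrightarrow> T (x \<oplus>\<^bsub>H\<^esub> y) = T x \<oplus>\<^bsub>H\<^esub> T y"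
    and sc: "\<And>c x. x \<in> carrier H \<Longrightarrow> T (c \<odot>\<^bsub>H\<^esub> x) = c \<odot>\<^bsub>H\<^esub> T x"
    using T by (auto simp: linear_operator_on_def)
  have "(x \<oplus>\<^bsub>H\<^esub> y) \<ominus>\<^bsub>H\<^esub> T (x \<oplus>\<^bsub>H\<^esub> y) = (x \<ominus>\<^bsub>H\<^esub> T x) \<oplus>\<^bsub>H\<^esub> (y \<ominus>\<^bsub>H\<^esub> T y)"
    if "x \<in> carrier H" "y \<in> carrier H" for x y
    using that by (intro hinner_eqI) (auto simp: cl ad hinner_diff_left hinner_add_left)
  moreover have "c \<odot>\<^bsub>H\<^esub> x \<ominus>\<^bsub>H\<^esub> T (c \<odot>\<^bsub>H\<^esub> x) = c \<odot>\<^bsub>H\<^esub> (x \<ominus>\<^bsub>H\<^esub> T x)"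
    if "x \<in> carrier H" for c x
    using that
    by (intro hinner_eqI) (auto simp: cl sc hinner_diff_left hinner_smult_left algebra_simps)
  ultimately show ?thesis
    by (simp add: linear_operator_on_def carrier_is_submodule cl)
qed

text \<open>
  Boundedness is automatic: from \<open>Y - Y\<^sup>2 = Y (1 - Y) Y + (1 - Y) Y (1 - Y) \<ge> 0\<close> it follows that
  \<open>\<langle>Y x, Y x\<rangle> \<le> \<langle>Y x, x\<rangle> \<le> \<langle>x, x\<rangle>\<close>, so \<open>1\<close> is a bound.
\<close>

lemma positive_contractionI:
  assumes lin: "linear_operator_on H (carrier H) Y" and sa: "self_adjoint H Y"
    and pos: "\<And>x. x \<in> carrier H \<Longrightarrow> hinner H (Y x) x \<in> \<real>\<^sub>\<ge>\<^sub>0"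
    and pos': "\<And>x. x \<in> carrier H \<Longrightarrow> hinner H (x \<ominus>\<^bsub>H\<^esub> Y x) x \<in> \<real>\<^sub>\<ge>\<^sub>0"
  shows "positive_contraction H Y"
proof -
  have cl: "\<And>x. x \<in> carrier H \<Longrightarrow> Y x \<in> carrier H"
    using lin by (auto simp: linear_operator_on_def)
  have "hnorm H (Y x) \<le> 1 * hnorm H x" if x: "x \<in> carrier H" for x
  proof -
    have "0 \<le> Re (hinner H (Y x \<ominus>\<^bsub>H\<^esub> Y (Y x)) (Y x))"
      using pos'[of "Y x"] cl x by (simp add: complex_nonneg_Reals_iff)
    then have 1: "Re (hinner H (Y (Y x)) (Y x)) \<le> Re (hinner H (Y x) (Y x))"
      using cl x by (simp add: hinner_diff_left)
    have "0 \<le> Re (hinner H (Y (x \<ominus>\<^bsub>H\<^esub> Y x)) (x \<ominus>\<^bsub>H\<^esub> Y x))"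
      using pos[of "x \<ominus>\<^bsub>H\<^esub> Y x"] cl x by (simp add: complex_nonneg_Reals_iff)
    moreover have "hinner H (Y (Y x)) x = hinner H (Y x) (Y x)"
      using sa cl x by (simp add: self_adjoint_def)
    ultimately have 2: "0 \<le> Re (hinner H (Y x) x) - 2 * Re (hinner H (Y x) (Y x))
        + Re (hinner H (Y (Y x)) (Y x))"
      using cl x by (simp add: linear_operator_on_diff[OF lin] hinner_diff_left hinner_diff_right)
    have "0 \<le> Re (hinner H (x \<ominus>\<^bsub>H\<^esub> Y x) x)"
      using pos'[of x] x by (simp add: complex_nonneg_Reals_iff)
    then have "Re (hinner H (Y x) x) \<le> Re (hinner H x x)"
      using cl x by (simp add: hinner_diff_left)
    with 1 2 show ?thesis
      by (simp add: hnorm_def)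
  qed
  then show ?thesis
    unfolding positive_contraction_def bounded_operator_def using lin sa pos pos' by blast
qed

text \<open>
  The quadratic form of \<open>a\<close> at coefficients \<open>c\<close> is \<open>\<langle>T z, z\<rangle>\<close> for \<open>z = \<Sum> c\<^sub>i \<alpha>(x\<^sub>i)\<close>.
\<close>

lemma positive_semidefinite_Gram:
  assumes T: "linear_operator_on H (carrier H) T"
    and pos: "\<And>x. x \<in> carrier H \<Longrightarrow> hinner H (T x) x \<in> \<real>\<^sub>\<ge>\<^sub>0"
    and \<alpha>: "\<And>n. n \<in> S \<Longrightarrow> \<alpha> n \<in> carrier H"
    and a: "\<And>m n. m \<in> S \<Longrightarrow> n \<in> S \<Longrightarrow> a m n = hinner H (T (\<alpha> n)) (\<alpha> m)"
  shows "positive_semidefinite S a"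
  unfolding positive_semidefinite_def
proof (intro allI impI)
  fix k :: nat and x c assume x: "\<forall>i<k. x i \<in> S"
  define z where "z = finsum H (\<lambda>i. c i \<odot>\<^bsub>H\<^esub> \<alpha> (x i)) {..<k}"
  have fn: "(\<lambda>i. \<alpha> (x i)) \<in> {..<k} \<rightarrow> carrier H"
    using x \<alpha> by auto
  have cl: "\<And>x. x \<in> carrier H \<Longrightarrow> T x \<in> carrier H"
    using T by (auto simp: linear_operator_on_def)
  then have fn': "(\<lambda>i. T (\<alpha> (x i))) \<in> {..<k} \<rightarrow> carrier H"
    using fn by auto
  have z: "z \<in> carrier H"
    unfolding z_def using fn by (rule lincomb_closed)
  have "T z = finsum H (\<lambda>i. c i \<odot>\<^bsub>H\<^esub> T (\<alpha> (x i))) {..<k}"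
    unfolding z_def using linear_operator_on_lincomb[OF T _ fn] by simp
  then have "hinner H (T z) z = (\<Sum>j<k. c j * hinner H (T (\<alpha> (x j))) z)"
    by (simp add: hinner_lincomb_left fn' z)
  also have "\<dots> = (\<Sum>j<k. \<Sum>i<k. a (x i) (x j) * c j * cnj (c i))"
  proof (rule sum.cong[OF refl])
    fix j assume "j \<in> {..<k}"
    then have "hinner H (T (\<alpha> (x j))) z = (\<Sum>i<k. cnj (c i) * a (x i) (x j))"
      using fn fn' x unfolding z_def
      by (subst hinner_lincomb_right) (auto simp: a Pi_iff intro!: sum.cong)
    then show "c j * hinner H (T (\<alpha> (x j))) z = (\<Sum>i<k. a (x i) (x j) * c j * cnj (c i))"
      by (simp add: sum_distrib_left mult_ac)
  qed
  also have "\<dots> = (\<Sum>i<k. \<Sum>j<k. a (x i) (x j) * c j * cnj (c i))"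
    by (rule sum.swap)
  finally show "(\<Sum>i<k. \<Sum>j<k. a (x i) (x j) * c j * cnj (c i)) \<in> \<real>\<^sub>\<ge>\<^sub>0"
    using pos[OF z] by simp
qed

end

section \<open>Functions on the index set and their shifts\<close>

lemma finite_index_set [simp]: "finite (index_set N)"
  by (rule finite_subset[of _ "{..N} \<times> {..N}"]) (auto simp: index_set_def)

lemma index_set_shift:
  assumes "n \<in> index_set (N - 1)"
  shows "n \<in> index_set N" "n + e1 \<in> index_set N" "n + e2 \<in> index_set N"
  using assms by (auto simp: index_set_def e1_def e2_def)

lemma shift_add: "n \<in> index_set (N - 1) \<Longrightarrow> shift N e f (n + e) = f n"
  by (auto simp: shift_def)

text \<open>
  A shift moves to its adjoint: this turns every statement about shifted functions into one
  about shifted matrix entries.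
\<close>

lemma sum_shift:
  assumes "\<And>n. n \<in> index_set (N - 1) \<Longrightarrow> n + e \<in> index_set N"
  shows "(\<Sum>y\<in>index_set N. g y * shift N e f y) = (\<Sum>n\<in>index_set (N - 1). g (n + e) * f n)"
proof -
  have "(\<Sum>n\<in>index_set (N - 1). g (n + e) * f n)
      = (\<Sum>n\<in>index_set (N - 1). g (n + e) * shift N e f (n + e))"
    by (simp add: shift_add)
  also have "\<dots> = (\<Sum>y\<in>(\<lambda>n. n + e) ` index_set (N - 1). g y * shift N e f y)"
    by (simp add: sum.reindex inj_on_def)
  also have "\<dots> = (\<Sum>y\<in>index_set N. g y * shift N e f y)"
    using assms by (intro sum.mono_neutral_left) (auto simp: shift_def)
  finally show ?thesis ..
qed

lemma matrix_apply_shift: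
  "matrix_apply (index_set N) a (shift N e1 f) m = (\<Sum>n\<in>index_set (N - 1). a m (n + e1) * f n)"
  "matrix_apply (index_set N) a (shift N e2 f) m = (\<Sum>n\<in>index_set (N - 1). a m (n + e2) * f n)"
  unfolding matrix_apply_def by (rule sum_shift, erule index_set_shift)+

lemma matrix_apply_supp:
  assumes "supp_on (index_set N) f \<subseteq> index_set (N - 1)"
  shows "matrix_apply (index_set N) a f m = (\<Sum>n\<in>index_set (N - 1). a m n * f n)"
  unfolding matrix_apply_def using assms
  by (intro sum.mono_neutral_right) (auto simp: index_set_shift[of _ N] supp_on_def)

lemma shift_arith:
  "shift N e (\<lambda>x. f x + g x) = (\<lambda>x. shift N e f x + shift N e g x)"
  "shift N e (\<lambda>x. f x - g x) = (\<lambda>x. shift N e f x - shift N e g x)"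
  "shift N e (\<lambda>x. c * f x) = (\<lambda>x. c * shift N e f x)"
  by (auto simp: shift_def)

lemma shift_point_mass:
  "n \<in> index_set (N - 1) \<Longrightarrow> shift N e (point_mass n) = point_mass (n + e)"
  by (auto simp: shift_def point_mass_def fun_eq_iff)

section \<open>The conditions hold for every Hankel pair\<close>

lemma Hankel_pair_conditions:
  assumes hvms: "finite_HVMS H N \<alpha> Y D A"
    and a1: "\<And>m n. m \<in> index_set N \<Longrightarrow> n \<in> index_set N \<Longrightarrow> a1 m n = hinner H (Y (\<alpha> n)) (\<alpha> m)"
    and a2: "\<And>m n. m \<in> index_set N \<Longrightarrow> n \<in> index_set N \<Longrightarrow>
      a2 m n = hinner H (\<alpha> n \<ominus>\<^bsub>H\<^esub> Y (\<alpha> n)) (\<alpha> m)"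
  shows "positive_semidefinite (index_set N) a1"
    and "positive_semidefinite (index_set N) a2"
    and "\<And>m n. m \<in> index_set (N - 1) \<Longrightarrow> n \<in> index_set (N - 1) \<Longrightarrow>
      a1 (m + e1) n + a2 (m + e2) n = a1 m (n + e1) + a2 m (n + e2)"
    and "\<And>l. l \<in> {1..N} \<Longrightarrow> a1 (0, l) (0, l) = 0"
    and "\<And>l. l \<in> {1..N} \<Longrightarrow> a2 (l, 0) (l, 0) = 0"
    and "\<And>f m. supp_on (index_set N) f \<subseteq> index_set (N - 1) \<Longrightarrow>
      \<forall>m\<in>index_set N. matrix_apply (index_set N) (\<lambda>x y. a1 x y + a2 x y) f m = 0 \<Longrightarrow>
      m \<in> index_set N \<Longrightarrow>
      matrix_apply (index_set N) a1 (shift N e1 f) m +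
      matrix_apply (index_set N) a2 (shift N e2 f) m = 0"
proof -
  interpret complex_hilbert_space H
    using hvms by (simp add: finite_HVMS_def)
  have \<alpha>: "\<And>n. n \<in> index_set N \<Longrightarrow> \<alpha> n \<in> carrier H"
    and pc: "positive_contraction H Y" and sym: "symmetric_operator H D A"
    and Y0: "\<And>l. l \<in> {1..N} \<Longrightarrow> Y (\<alpha> (0, l)) = \<zero>\<^bsub>H\<^esub>"
    and Y1: "\<And>l. l \<in> {1..N} \<Longrightarrow> \<alpha> (l, 0) \<ominus>\<^bsub>H\<^esub> Y (\<alpha> (l, 0)) = \<zero>\<^bsub>H\<^esub>"
    using hvms by (simp_all add: finite_HVMS_def)
  have linY: "linear_operator_on H (carrier H) Y" and saY: "self_adjoint H Y"
    using pc by (auto simp: positive_contraction_def bounded_operator_def)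
  have linA: "linear_operator_on H D A"
    and symA: "\<And>x y. x \<in> D \<Longrightarrow> y \<in> D \<Longrightarrow> hinner H (A x) y = hinner H x (A y)"
    using sym by (auto simp: symmetric_operator_def)
  have clY [simp]: "\<And>x. x \<in> carrier H \<Longrightarrow> Y x \<in> carrier H"
    using linY by (auto simp: linear_operator_on_def)
  have D: "\<alpha> n \<in> D"
    and A: "A (\<alpha> n) = Y (\<alpha> (n + e1)) \<oplus>\<^bsub>H\<^esub> (\<alpha> (n + e2) \<ominus>\<^bsub>H\<^esub> Y (\<alpha> (n + e2)))"
    if "n \<in> index_set (N - 1)" for n
  proof -
    have "2 \<le> N"
      using that by (auto simp: index_set_def)
    then show "\<alpha> n \<in> D"
      "A (\<alpha> n) = Y (\<alpha> (n + e1)) \<oplus>\<^bsub>H\<^esub> (\<alpha> (n + e2) \<ominus>\<^bsub>H\<^esub> Y (\<alpha> (n + e2)))"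
      using hvms that by (simp_all add: finite_HVMS_def)
  qed
  \<comment> \<open>These two identities express the entries of \<open>A\<close> on the moment vectors, read from either side;
    symmetry of \<open>A\<close> equates them.\<close>
  have A_left: "hinner H (A (\<alpha> n)) (\<alpha> m) = a1 m (n + e1) + a2 m (n + e2)"
    if "n \<in> index_set (N - 1)" "m \<in> index_set N" for m n
    using that by (simp add: A a1 a2 \<alpha> index_set_shift[of _ N] hinner_add_left)
  have A_right: "hinner H (\<alpha> n) (A (\<alpha> m)) = a1 (m + e1) n + a2 (m + e2) n"
    if "m \<in> index_set (N - 1)" "n \<in> index_set N" for m n
    using that saY
    by (simp add: A a1 a2 \<alpha> index_set_shift[of _ N] hinner_add_right hinner_diff_right hinner_diff_left
        self_adjoint_def)
  show "positive_semidefinite (index_set N) a1"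
    using pc by (intro positive_semidefinite_Gram[OF linY _ \<alpha> a1])
      (auto simp: positive_contraction_def)
  show "positive_semidefinite (index_set N) a2"
    using pc by (intro positive_semidefinite_Gram[OF linear_operator_on_complement[OF linY] _ \<alpha> a2])
      (auto simp: positive_contraction_def)
  show "a1 (m + e1) n + a2 (m + e2) n = a1 m (n + e1) + a2 m (n + e2)"
    if "m \<in> index_set (N - 1)" "n \<in> index_set (N - 1)" for m n
    using symA[of "\<alpha> n" "\<alpha> m"] that by (simp add: A_left A_right D index_set_shift[of _ N])
  show "a1 (0, l) (0, l) = 0" if "l \<in> {1..N}" for l
  proof -
    have "(0, l) \<in> index_set N"
      using that by (simp add: index_set_def)
    then show ?thesis
      using that by (simp add: a1 Y0 \<alpha>)
  qed
  show "a2 (l, 0) (l, 0) = 0" if "l \<in> {1..N}" for l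
  proof -
    have "(l, 0) \<in> index_set N"
      using that by (simp add: index_set_def)
    then show ?thesis
      using that by (simp add: a2 Y1 \<alpha>)
  qed
  fix f m
  assume supp: "supp_on (index_set N) f \<subseteq> index_set (N - 1)"
    and null: "\<forall>m\<in>index_set N. matrix_apply (index_set N) (\<lambda>x y. a1 x y + a2 x y) f m = 0"
    and m: "m \<in> index_set N"
  \<comment> \<open>The hypothesis says that \<open>z\<close> is orthogonal to all moment vectors, hence to itself.\<close>
  define z where "z = finsum H (\<lambda>n. f n \<odot>\<^bsub>H\<^esub> \<alpha> n) (index_set (N - 1))"
  have fin: "finite (index_set (N - 1))"
    by simp
  have fn: "\<alpha> \<in> index_set (N - 1) \<rightarrow> carrier H" and fnD: "\<alpha> \<in> index_set (N - 1) \<rightarrow> D"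
    using \<alpha> D by (auto simp: index_set_shift[of _ N])
  have fnA: "(\<lambda>n. A (\<alpha> n)) \<in> index_set (N - 1) \<rightarrow> carrier H"
    using \<alpha> by (auto simp: A index_set_shift[of _ N])
  have z: "z \<in> carrier H"
    unfolding z_def using fn by (rule lincomb_closed)
  have "hinner H z (\<alpha> n) = 0" if "n \<in> index_set N" for n
  proof -
    have "hinner H (\<alpha> i) (\<alpha> n) = a1 n i + a2 n i" if "i \<in> index_set (N - 1)" for i
      using that \<open>n \<in> index_set N\<close> by (simp add: a1 a2 \<alpha> index_set_shift[of _ N] hinner_diff_left)
    then have "hinner H z (\<alpha> n) = (\<Sum>i\<in>index_set (N - 1). (a1 n i + a2 n i) * f i)"
      unfolding z_def hinner_lincomb_left[OF fin fn \<alpha>[OF that]]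
      by (intro sum.cong refl) (simp add: mult.commute)
    then show ?thesis
      using null that by (simp add: matrix_apply_supp[OF supp])
  qed
  then have "hinner H z z = 0"
    using hinner_lincomb_right[OF fin fn z, of f, folded z_def] by (simp add: index_set_shift[of _ N])
  then have "z = \<zero>\<^bsub>H\<^esub>"
    by (rule hinner_definite[OF z])
  then have "A z = \<zero>\<^bsub>H\<^esub>"
    using linear_operator_on_zero[OF linA] by simp
  moreover have "A z = finsum H (\<lambda>n. f n \<odot>\<^bsub>H\<^esub> A (\<alpha> n)) (index_set (N - 1))"
    unfolding z_def using linear_operator_on_lincomb[OF linA fin fnD] by simp
  ultimately have "hinner H (finsum H (\<lambda>n. f n \<odot>\<^bsub>H\<^esub> A (\<alpha> n)) (index_set (N - 1))) (\<alpha> m) = 0"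
    using m \<alpha> by simp
  then show "matrix_apply (index_set N) a1 (shift N e1 f) m +
      matrix_apply (index_set N) a2 (shift N e2 f) m = 0"
    using m by (simp only: hinner_lincomb_left[OF fin fnA \<alpha>[OF m]] A_left[OF _ m] matrix_apply_shift
        sum.distrib distrib_left mult.commute[of _ "f _"] cong: sum.cong)
qed

section \<open>Coordinates for a pair of positive semi-definite matrices\<close>

definition coord_vecs :: "nat \<Rightarrow> (nat \<Rightarrow> complex) set" where
  "coord_vecs k = {v. \<forall>i\<ge>k. v i = 0}"

lemma coord_vecs_closed [simp, intro]:
  "(\<lambda>_. 0) \<in> coord_vecs k"
  "v \<in> coord_vecs k \<Longrightarrow> w \<in> coord_vecs k \<Longrightarrow> (\<lambda>i. v i + w i) \<in> coord_vecs k"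
  "v \<in> coord_vecs k \<Longrightarrow> w \<in> coord_vecs k \<Longrightarrow> (\<lambda>i. v i - w i) \<in> coord_vecs k"
  "v \<in> coord_vecs k \<Longrightarrow> (\<lambda>i. c * v i) \<in> coord_vecs k"
  "v \<in> coord_vecs k \<Longrightarrow> (\<lambda>i. - v i) \<in> coord_vecs k"
  by (simp_all add: coord_vecs_def)

text \<open>
  A finite system that is orthonormal for the form of \<open>a1 + a2\<close> and spans modulo its null
  space; the second property is stated as Parseval's identity.
\<close>

locale psd_pair_frame =
  p1: psd_matrix S a1 + p2: psd_matrix S a2
  for S :: "'x set" and a1 a2 :: "'x \<Rightarrow> 'x \<Rightarrow> complex" +
  fixes k :: nat and u :: "nat \<Rightarrow> 'x \<Rightarrow> complex"
  assumes orthonormal: "\<And>i j. i < k \<Longrightarrow> j < k \<Longrightarrow>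
      sesq S (\<lambda>x y. a1 x y + a2 x y) (u i) (u j) = (if i = j then 1 else 0)"
    and expansion: "\<And>f h. sesq S (\<lambda>x y. a1 x y + a2 x y) f h =
      (\<Sum>i<k. sesq S (\<lambda>x y. a1 x y + a2 x y) f (u i) *
        sesq S (\<lambda>x y. a1 x y + a2 x y) (u i) h)"
begin

abbreviation a :: "'x \<Rightarrow> 'x \<Rightarrow> complex" where
  "a \<equiv> (\<lambda>x y. a1 x y + a2 x y)"

text \<open>
  The functional \<open>g \<mapsto> b(f, g)\<close> as a coordinate vector. For \<open>b = a\<close> these are the coordinates of
  the class of \<open>f\<close>, and \<open>synth\<close> picks a representative of a class. Coordinates from \<open>k\<close> on are
  \<open>0\<close>, so that equality of classes is equality of functions.
\<close>

definition coords :: "('x \<Rightarrow> 'x \<Rightarrow> complex) \<Rightarrow> ('x \<Rightarrow> complex) \<Rightarrow> nat \<Rightarrow> complex" where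
  "coords b f i = (if i < k then sesq S b f (u i) else 0)"

definition synth :: "(nat \<Rightarrow> complex) \<Rightarrow> 'x \<Rightarrow> complex" where
  "synth v x = (\<Sum>i<k. v i * u i x)"

lemma coords_in [simp, intro]: "coords b f \<in> coord_vecs k"
  by (simp add: coords_def coord_vecs_def)

lemma coords_zero: "coords b (\<lambda>_. 0) = (\<lambda>_. 0)"
  by (auto simp: coords_def sesq_zero_left)

lemma coords_add: "coords b (\<lambda>x. f x + g x) = (\<lambda>i. coords b f i + coords b g i)"
  by (auto simp: coords_def sesq_add_left)

lemma coords_diff: "coords b (\<lambda>x. f x - g x) = (\<lambda>i. coords b f i - coords b g i)"
  by (auto simp: coords_def sesq_diff_left)

lemma coords_scale: "coords b (\<lambda>x. c * f x) = (\<lambda>i. c * coords b f i)"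
  by (auto simp: coords_def sesq_scale_left)

lemma coords_pair: "coords a f = (\<lambda>i. coords a1 f i + coords a2 f i)"
  by (auto simp: coords_def sesq_add_matrix)

lemma coords_synth:
  assumes "v \<in> coord_vecs k"
  shows "coords a (synth v) = v"
proof
  fix j
  have "sesq S a (synth v) (u j) = v j" if "j < k"
  proof -
    have "sesq S a (synth v) (u j) = (\<Sum>i<k. v i * sesq S a (u i) (u j))"
      unfolding synth_def by (rule sesq_sum_left)
    also have "\<dots> = (\<Sum>i<k. if i = j then v i else 0)"
      using that by (intro sum.cong) (auto simp: orthonormal)
    finally show ?thesis
      using that by simp
  qed
  then show "coords a (synth v) j = v j"
    using assms by (auto simp: coords_def coord_vecs_def)
qed

text \<open>
  Both summands are non-negative, so a null vector of the sum is null for each of them.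
\<close>

lemma sesq_pair_null:
  assumes "\<And>h. sesq S a f h = 0"
  shows "sesq S a1 f h = 0" "sesq S a2 f h = 0"
proof -
  have "sesq S a1 f f + sesq S a2 f f = 0"
    using assms[of f] by (simp add: sesq_add_matrix)
  then have "Re (sesq S a1 f f) + Re (sesq S a2 f f) = 0"
    by (metis plus_complex.sel(1) zero_complex.sel(1))
  then have "sesq S a1 f f = 0" "sesq S a2 f f = 0"
    using p1.Re_sesq_nonneg[of f] p2.Re_sesq_nonneg[of f]
    by (auto simp: complex_eq_iff p1.Im_sesq_self p2.Im_sesq_self)
  then show "sesq S a1 f h = 0" "sesq S a2 f h = 0"
    by (simp_all add: p1.sesq_null p2.sesq_null)
qed

text \<open>
  The representative of the class of \<open>f\<close> differs from \<open>f\<close> by a null vector of \<open>a\<close>; so the forms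
  of \<open>a1\<close> and \<open>a2\<close> depend only on classes.
\<close>

lemma sesq_pair_expansion:
  shows "sesq S a1 f h = sesq S a1 (synth (coords a f)) h"
    and "sesq S a2 f h = sesq S a2 (synth (coords a f)) h"
proof -
  define r where "r = (\<lambda>x. f x - synth (coords a f) x)"
  have "sesq S a (synth (coords a f)) g = (\<Sum>i<k. sesq S a f (u i) * sesq S a (u i) g)" for g
    unfolding synth_def by (simp add: sesq_sum_left coords_def)
  then have "sesq S a r g = 0" for g
    unfolding r_def sesq_diff_left by (simp flip: expansion)
  note null = sesq_pair_null[OF this, of h]
  show "sesq S a1 f h = sesq S a1 (synth (coords a f)) h"
    using null(1) by (simp add: r_def sesq_diff_left)
  show "sesq S a2 f h = sesq S a2 (synth (coords a f)) h"
    using null(2) by (simp add: r_def sesq_diff_left)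
qed

lemma coords1_synth: "coords a1 (synth (coords a f)) = coords a1 f"
  by (auto simp: coords_def simp flip: sesq_pair_expansion)

text \<open>
  This is what makes \<open>coords a1 f\<close> the image of the class of \<open>f\<close> under the operator that represents
  the form of \<open>a1\<close>; similarly for \<open>a2\<close>.
\<close>

lemma coords1_pairing: "(\<Sum>i<k. coords a1 f i * cnj (coords a g i)) = sesq S a1 f g"
proof -
  have "sesq S a1 g f = (\<Sum>i<k. coords a g i * sesq S a1 (u i) f)"
    unfolding sesq_pair_expansion(1)[of g] synth_def by (rule sesq_sum_left)
  then have "sesq S a1 f g = cnj (\<Sum>i<k. coords a g i * sesq S a1 (u i) f)"
    using p1.sesq_hermitian[of f g] by simp
  then show ?thesis
    by (simp add: coords_def mult.commute flip: p1.sesq_hermitian)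
qed

lemma coords2_pairing: "(\<Sum>i<k. coords a2 f i * cnj (coords a g i)) = sesq S a2 f g"
proof -
  have "sesq S a2 g f = (\<Sum>i<k. coords a g i * sesq S a2 (u i) f)"
    unfolding sesq_pair_expansion(2)[of g] synth_def by (rule sesq_sum_left)
  then have "sesq S a2 f g = cnj (\<Sum>i<k. coords a g i * sesq S a2 (u i) f)"
    using p2.sesq_hermitian[of f g] by simp
  then show ?thesis
    by (simp add: coords_def mult.commute flip: p2.sesq_hermitian)
qed

end

section \<open>Coordinate spaces inside a given type\<close>

text \<open>
  Finitely many complex numbers are packed into one by iterating an injection \<open>p\<close> of pairs.
\<close>

primrec encode :: "(complex \<times> complex \<Rightarrow> complex) \<Rightarrow> nat \<Rightarrow> (nat \<Rightarrow> complex) \<Rightarrow> complex" where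
  "encode p 0 v = 0"
| "encode p (Suc k) v = p (encode p k v, v k)"

lemma encode_eqD:
  assumes "inj p" "encode p k v = encode p k w" "i < k"
  shows "v i = w i"
  using assms(2,3)
proof (induction k)
  case (Suc k)
  then show ?case
    using injD[OF assms(1), of "(encode p k v, v k)" "(encode p k w, w k)"]
    by (auto simp: less_Suc_eq)
qed simp

lemma coord_vecs_embedding:
  obtains \<phi> :: "(nat \<Rightarrow> complex) \<Rightarrow> complex" where "inj_on \<phi> (coord_vecs k)"
proof -
  have "infinite (UNIV :: complex set)"
    by (simp add: infinite_UNIV_char_0)
  then have "\<exists>p. bij_betw p (UNIV \<times> UNIV :: (complex \<times> complex) set) (UNIV :: complex set)"
    unfolding card_of_ordIso by (rule card_of_Times_same_infinite)
  then obtain p :: "complex \<times> complex \<Rightarrow> complex" where p: "inj p"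
    by (auto simp: bij_betw_def)
  have "inj_on (encode p k) (coord_vecs k)"
  proof (rule inj_onI, rule ext)
    fix v w i assume "v \<in> coord_vecs k" "w \<in> coord_vecs k" "encode p k v = encode p k w"
    then show "v i = w i"
      using encode_eqD[OF p, of k v w i] by (cases "i < k") (auto simp: coord_vecs_def)
  qed
  then show thesis
    by (rule that)
qed

text \<open>
  The Hilbert space of \<open>k\<close>-tuples transported along \<open>\<phi>\<close>, so that its carrier lies in a type chosen
  in advance.
\<close>

definition coord_space :: "nat \<Rightarrow> ((nat \<Rightarrow> complex) \<Rightarrow> 'h) \<Rightarrow> 'h hilbert_record" where
  "coord_space k \<phi> = (let \<psi> = inv_into (coord_vecs k) \<phi> in
     \<lparr>carrier = \<phi> ` coord_vecs k, mult = undefined, one = undefined,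
      zero = \<phi> (\<lambda>_. 0), add = (\<lambda>x y. \<phi> (\<lambda>i. \<psi> x i + \<psi> y i)),
      smult = (\<lambda>c x. \<phi> (\<lambda>i. c * \<psi> x i)),
      hinner = (\<lambda>x y. \<Sum>i<k. \<psi> x i * cnj (\<psi> y i))\<rparr>)"

locale coord_embedding =
  fixes k :: nat and \<phi> :: "(nat \<Rightarrow> complex) \<Rightarrow> 'h"
  assumes inj: "inj_on \<phi> (coord_vecs k)"
begin

abbreviation "H \<equiv> coord_space k \<phi>"
abbreviation "\<psi> \<equiv> inv_into (coord_vecs k) \<phi>"

lemma \<psi>_\<phi> [simp]: "v \<in> coord_vecs k \<Longrightarrow> \<psi> (\<phi> v) = v"
  using inj by simp

lemma carrier_H: "carrier H = \<phi> ` coord_vecs k"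
  by (simp add: coord_space_def Let_def)

lemma \<phi>_closed [simp, intro]: "v \<in> coord_vecs k \<Longrightarrow> \<phi> v \<in> carrier H"
  by (simp add: carrier_H)

lemma zero_H: "\<zero>\<^bsub>H\<^esub> = \<phi> (\<lambda>_. 0)"
  by (simp add: coord_space_def Let_def)

lemma add_H [simp]:
  "v \<in> coord_vecs k \<Longrightarrow> w \<in> coord_vecs k \<Longrightarrow> \<phi> v \<oplus>\<^bsub>H\<^esub> \<phi> w = \<phi> (\<lambda>i. v i + w i)"
  by (simp add: coord_space_def Let_def)

lemma smult_H [simp]: "v \<in> coord_vecs k \<Longrightarrow> c \<odot>\<^bsub>H\<^esub> \<phi> v = \<phi> (\<lambda>i. c * v i)"
  by (simp add: coord_space_def Let_def)

lemma hinner_H [simp]: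
  "v \<in> coord_vecs k \<Longrightarrow> w \<in> coord_vecs k \<Longrightarrow> hinner H (\<phi> v) (\<phi> w) = (\<Sum>i<k. v i * cnj (w i))"
  by (simp add: coord_space_def Let_def)

lemma carrier_H_cases:
  assumes "x \<in> carrier H"
  obtains v where "v \<in> coord_vecs k" "x = \<phi> v"
  using assms by (auto simp: carrier_H)

lemma abelian_group_H: "abelian_group H"
proof (rule abelian_groupI)
  fix x assume "x \<in> carrier H"
  then obtain v where v: "v \<in> coord_vecs k" "x = \<phi> v"
    by (rule carrier_H_cases)
  then show "\<exists>y\<in>carrier H. y \<oplus>\<^bsub>H\<^esub> x = \<zero>\<^bsub>H\<^esub>"
    by (intro bexI[of _ "\<phi> (\<lambda>i. - v i)"]) (auto simp: zero_H)
qed (auto elim!: carrier_H_cases simp: zero_H algebra_simps)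

lemma minus_H [simp]:
  assumes "v \<in> coord_vecs k" "w \<in> coord_vecs k"
  shows "\<phi> v \<ominus>\<^bsub>H\<^esub> \<phi> w = \<phi> (\<lambda>i. v i - w i)"
proof -
  interpret abelian_group H by (rule abelian_group_H)
  have "\<ominus>\<^bsub>H\<^esub> \<phi> w = \<phi> (\<lambda>i. - w i)"
    using assms by (intro minus_equality) (auto simp: zero_H)
  then show ?thesis
    using assms by (simp add: a_minus_def)
qed

lemma module_H: "module (ring_of_type_algebra :: complex ring) H"
  by (rule moduleI[OF cring_from_type_algebra abelian_group_H])
    (auto elim!: carrier_H_cases simp: algebra_simps)

lemma hnorm_H:
  assumes "v \<in> coord_vecs k"
  shows "hnorm H (\<phi> v) = L2_set (\<lambda>i. cmod (v i)) {..<k}"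
  using assms unfolding hnorm_def L2_set_def
  by (simp add: cmod_power2 power2_eq_square[of "Re _"] power2_eq_square[of "Im _"])

lemma hdist_H:
  assumes "v \<in> coord_vecs k" "w \<in> coord_vecs k"
  shows "hdist H (\<phi> v) (\<phi> w) = L2_set (\<lambda>i. cmod (v i - w i)) {..<k}"
  using assms by (simp add: hdist_def hnorm_H)

lemma Metric_space_H: "Metric_space (carrier H) (hdist H)"
proof
  fix x y show "0 \<le> hdist H x y"
    by (auto simp: hdist_def hnorm_H elim!: carrier_H_cases)
next
  fix x y show "hdist H x y = hdist H y x"
    by (auto simp: hdist_def hnorm_H norm_minus_commute elim!: carrier_H_cases)
next
  fix x y assume "x \<in> carrier H" "y \<in> carrier H"
  then obtain v w where vw: "v \<in> coord_vecs k" "x = \<phi> v" "w \<in> coord_vecs k" "y = \<phi> w"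
    by (metis carrier_H_cases)
  have "(\<forall>i<k. v i = w i) \<longleftrightarrow> v = w"
    using vw by (auto simp: coord_vecs_def fun_eq_iff) (metis leI)
  then show "hdist H x y = 0 \<longleftrightarrow> x = y"
    using vw inj by (auto simp: hdist_H L2_set_eq_0_iff inj_on_eq_iff)
next
  fix x y z assume "x \<in> carrier H" "y \<in> carrier H" "z \<in> carrier H"
  then obtain u v w where uvw: "u \<in> coord_vecs k" "x = \<phi> u" "v \<in> coord_vecs k" "y = \<phi> v"
      "w \<in> coord_vecs k" "z = \<phi> w"
    by (metis carrier_H_cases)
  have "L2_set (\<lambda>i. cmod (u i - w i)) {..<k}
      \<le> L2_set (\<lambda>i. cmod (u i - v i) + cmod (v i - w i)) {..<k}"
    by (intro L2_set_mono norm_diff_triangle_le[OF order_refl order_refl] norm_ge_zero)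
  also have "\<dots> \<le> L2_set (\<lambda>i. cmod (u i - v i)) {..<k} + L2_set (\<lambda>i. cmod (v i - w i)) {..<k}"
    by (rule L2_set_triangle_ineq)
  finally show "hdist H x z \<le> hdist H x y + hdist H y z"
    using uvw by (simp add: hdist_H)
qed

lemma mcomplete_H: "Metric_space.mcomplete (carrier H) (hdist H)"
proof -
  interpret Metric_space "carrier H" "hdist H"
    by (rule Metric_space_H)
  show ?thesis
    unfolding mcomplete_def
  proof (intro allI impI)
    fix \<sigma> assume \<sigma>: "MCauchy \<sigma>"
    define v where "v n = \<psi> (\<sigma> n)" for n
    have v: "v n \<in> coord_vecs k" "\<sigma> n = \<phi> (v n)" for n
    proof -
      have "\<sigma> n \<in> carrier H"
        using \<sigma> by (auto simp: MCauchy_def)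
      then show "v n \<in> coord_vecs k" "\<sigma> n = \<phi> (v n)"
        by (auto simp: v_def elim!: carrier_H_cases)
    qed
    have "Cauchy (\<lambda>n. v n i)" if "i < k" for i
    proof (rule metric_CauchyI)
      fix e :: real assume "0 < e"
      then obtain M where M: "\<And>m n. M \<le> m \<Longrightarrow> M \<le> n \<Longrightarrow> hdist H (\<sigma> m) (\<sigma> n) < e"
        using \<sigma> unfolding MCauchy_def by meson
      have "dist (v m i) (v n i) \<le> hdist H (\<sigma> m) (\<sigma> n)" for m n
        using member_le_L2_set[of "{..<k}" i "\<lambda>i. cmod (v m i - v n i)"] that
        by (simp add: v hdist_H dist_norm)
      then show "\<exists>M. \<forall>m\<ge>M. \<forall>n\<ge>M. dist (v m i) (v n i) < e"
        using M by (meson le_less_trans)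
    qed
    then have "\<exists>l. (\<lambda>n. v n i) \<longlonglongrightarrow> l" if "i < k" for i
      using that Cauchy_convergent convergent_def by blast
    then obtain l' where l': "\<And>i. i < k \<Longrightarrow> (\<lambda>n. v n i) \<longlonglongrightarrow> l' i"
      by metis
    define l where "l i = (if i < k then l' i else 0)" for i
    have l: "l \<in> coord_vecs k"
      by (simp add: l_def coord_vecs_def)
    have "(\<lambda>n. L2_set (\<lambda>i. cmod (v n i - l i)) {..<k}) \<longlonglongrightarrow> 0"
    proof (rule tendsto_sandwich[OF _ _ tendsto_const])
      show "\<forall>\<^sub>F n in sequentially. L2_set (\<lambda>i. cmod (v n i - l i)) {..<k}
          \<le> (\<Sum>i<k. cmod (v n i - l i))"
        by (intro always_eventually allI L2_set_le_sum norm_ge_zero)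
      have "(\<lambda>n. \<Sum>i<k. cmod (v n i - l i)) \<longlonglongrightarrow> (\<Sum>i<k. cmod (l i - l i))"
        by (intro tendsto_intros) (auto simp: l_def l')
      then show "(\<lambda>n. \<Sum>i<k. cmod (v n i - l i)) \<longlonglongrightarrow> 0"
        by simp
    qed auto
    then show "\<exists>x. limitin mtopology \<sigma> x sequentially"
      using l v by (auto simp: limitin_metric_dist_null hdist_H intro!: exI[of _ "\<phi> l"])
  qed
qed

sublocale complex_hilbert_space H
proof (intro complex_hilbert_space.intro complex_hilbert_space_axioms.intro module_H mcomplete_H)
  fix x assume "x \<in> carrier H" and "hinner H x x = 0"
  then have "hdist H x \<zero>\<^bsub>H\<^esub> = 0"
    by (auto simp: hdist_H hnorm_def zero_H hdist_def elim!: carrier_H_cases)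
  then show "x = \<zero>\<^bsub>H\<^esub>"
    using Metric_space.zero[OF Metric_space_H] \<open>x \<in> carrier H\<close> by (auto simp: zero_H)
qed (auto elim!: carrier_H_cases
    simp: sum.distrib sum_distrib_left algebra_simps complex_nonneg_Reals_iff sum_nonneg)

end

section \<open>Constructing a Hankel vector moment sequence\<close>

locale embedded_psd_pair_frame =
  psd_pair_frame S a1 a2 k u + coord_embedding k \<phi>
  for S :: "'x set" and a1 a2 :: "'x \<Rightarrow> 'x \<Rightarrow> complex" and k u
    and \<phi> :: "(nat \<Rightarrow> complex) \<Rightarrow> 'h"
begin

text \<open>
  Applied to the class of a function \<open>f\<close>, this is \<open>coords a1 f\<close>; going through \<open>synth\<close> makes it a
  function of the class.
\<close>

definition Y :: "'h \<Rightarrow> 'h" where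
  "Y x = \<phi> (coords a1 (synth (\<psi> x)))"

lemma Y_\<phi>: "v \<in> coord_vecs k \<Longrightarrow> Y (\<phi> v) = \<phi> (coords a1 (synth v))"
  by (simp add: Y_def)

lemma Y_coords [simp]: "Y (\<phi> (coords a f)) = \<phi> (coords a1 f)"
  by (simp add: Y_\<phi> coords1_synth)

lemma complement_Y_coords [simp]: "\<phi> (coords a f) \<ominus>\<^bsub>H\<^esub> Y (\<phi> (coords a f)) = \<phi> (coords a2 f)"
proof -
  have "(\<lambda>i. coords a f i - coords a1 f i) = coords a2 f"
    by (simp add: coords_pair)
  then show ?thesis
    by simp
qed

lemma carrier_H_coords:
  assumes "x \<in> carrier H"
  obtains f where "x = \<phi> (coords a f)"
proof -
  from assms obtain v where "v \<in> coord_vecs k" "x = \<phi> v"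
    by (rule carrier_H_cases)
  then show thesis
    using that[of "synth v"] by (simp add: coords_synth)
qed

lemma hinner_coords1: "hinner H (\<phi> (coords a1 f)) (\<phi> (coords a g)) = sesq S a1 f g"
  by (simp add: coords1_pairing)

lemma hinner_coords2: "hinner H (\<phi> (coords a2 f)) (\<phi> (coords a g)) = sesq S a2 f g"
  by (simp add: coords2_pairing)

lemma positive_contraction_Y: "positive_contraction H Y"
proof (rule positive_contractionI)
  have "\<phi> (coords a f) \<oplus>\<^bsub>H\<^esub> \<phi> (coords a g) = \<phi> (coords a (\<lambda>x. f x + g x))" for f g
    by (simp add: coords_add)
  moreover have "c \<odot>\<^bsub>H\<^esub> \<phi> (coords a f) = \<phi> (coords a (\<lambda>x. c * f x))" for c f
    by (simp add: coords_scale)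
  ultimately show "linear_operator_on H (carrier H) Y"
    unfolding linear_operator_on_def
    by (auto simp: carrier_is_submodule coords_add[of a1] coords_scale[of a1] elim!: carrier_H_coords)
  have "hinner H (\<phi> (coords a f)) (\<phi> (coords a1 g)) = sesq S a1 f g" for f g
    using hinner_cnj_commute[of "\<phi> (coords a1 g)" "\<phi> (coords a f)"] hinner_coords1[of g f]
      p1.sesq_hermitian[of f g] by simp
  then show "self_adjoint H Y"
    unfolding self_adjoint_def
    by (auto simp: hinner_coords1 simp del: hinner_H elim!: carrier_H_coords)
  fix x assume "x \<in> carrier H"
  then obtain f where x: "x = \<phi> (coords a f)"
    by (rule carrier_H_coords)
  show "hinner H (Y x) x \<in> \<real>\<^sub>\<ge>\<^sub>0"
    unfolding x Y_coords hinner_coords1 by (rule p1.sesq_nonneg)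
  show "hinner H (x \<ominus>\<^bsub>H\<^esub> Y x) x \<in> \<real>\<^sub>\<ge>\<^sub>0"
    unfolding x complement_Y_coords hinner_coords2 by (rule p2.sesq_nonneg)
qed

end

text \<open>
  The kernel condition makes \<open>A\<close> well defined, the Hankel identity makes it symmetric, and the
  diagonal zeros say that the point masses concerned are null for \<open>a1\<close> or \<open>a2\<close>, so that the
  operator representing that form kills their classes.
\<close>

lemma finite_HVMS_exists:
  fixes \<iota> :: "complex \<Rightarrow> 'h"
  assumes "inj \<iota>"
    and psd1: "positive_semidefinite (index_set N) a1"
    and psd2: "positive_semidefinite (index_set N) a2"
    and Hankel: "\<And>m n. m \<in> index_set (N - 1) \<Longrightarrow> n \<in> index_set (N - 1) \<Longrightarrow>
       a1 (m + e1) n + a2 (m + e2) n = a1 m (n + e1) + a2 m (n + e2)"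
    and diag1: "\<And>l. l \<in> {1..N} \<Longrightarrow> a1 (0, l) (0, l) = 0"
    and diag2: "\<And>l. l \<in> {1..N} \<Longrightarrow> a2 (l, 0) (l, 0) = 0"
    and kernel: "\<And>f m. supp_on (index_set N) f \<subseteq> index_set (N - 1) \<Longrightarrow>
       \<forall>m\<in>index_set N. matrix_apply (index_set N) (\<lambda>x y. a1 x y + a2 x y) f m = 0 \<Longrightarrow>
       m \<in> index_set N \<Longrightarrow>
       matrix_apply (index_set N) a1 (shift N e1 f) m +
       matrix_apply (index_set N) a2 (shift N e2 f) m = 0"
  shows "finite_Hankel_pair TYPE('h) N a1 a2"
proof -
  let ?I = "index_set N"
  let ?I' = "index_set (N - 1)"
  let ?a = "\<lambda>x y. a1 x y + a2 x y"
  interpret p1: psd_matrix ?I a1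
    using psd1 by unfold_locales auto
  interpret p2: psd_matrix ?I a2
    using psd2 by unfold_locales auto
  interpret p: psd_matrix ?I ?a
    using psd1 psd2 by unfold_locales
      (auto simp: positive_semidefinite_def distrib_right sum.distrib intro!: nonneg_Reals_add_I)
  obtain k u where "psd_pair_frame ?I a1 a2 k u"
  proof (rule p.orthonormal_expansion)
    fix k :: nat and u
    assume "\<And>i j. i < k \<Longrightarrow> j < k \<Longrightarrow> sesq ?I ?a (u i) (u j) = (if i = j then 1 else 0)"
      and "\<And>f h. sesq ?I ?a f h = (\<Sum>i<k. sesq ?I ?a f (u i) * sesq ?I ?a (u i) h)"
    then have "psd_pair_frame ?I a1 a2 k u"
      by unfold_locales
    then show thesis
      by (rule that)
  qed
  then interpret psd_pair_frame ?I a1 a2 k u .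
  obtain \<phi>' :: "(nat \<Rightarrow> complex) \<Rightarrow> complex" where \<phi>': "inj_on \<phi>' (coord_vecs k)"
    by (rule coord_vecs_embedding)
  define \<phi> where "\<phi> = \<iota> \<circ> \<phi>'"
  have "inj_on \<phi> (coord_vecs k)"
    unfolding \<phi>_def using \<phi>' assms(1) by (meson comp_inj_on inj_on_subset subset_UNIV)
  then interpret embedded_psd_pair_frame ?I a1 a2 k u \<phi>
    by unfold_locales
  define \<alpha> where "\<alpha> n = \<phi> (coords ?a (point_mass n))" for n
  \<comment> \<open>The domain of \<open>A\<close> consists of the classes of functions that vanish off the smaller index set.\<close>
  define supported where "supported f \<longleftrightarrow> (\<forall>n\<in>?I. n \<notin> ?I' \<longrightarrow> f n = 0)" for f :: "nat \<times> nat \<Rightarrow> complex"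
  \<comment> \<open>The coordinates of \<open>Y S\<^sub>1 f + (1 - Y) S\<^sub>2 f\<close>, the intended value of \<open>A\<close> at the class of \<open>f\<close>.\<close>
  define b where "b f i = coords a1 (shift N e1 f) i + coords a2 (shift N e2 f) i" for f i
  have b_in [simp]: "b f \<in> coord_vecs k" for f
    unfolding b_def by simp
  have hinner_b: "hinner H (\<phi> (b f)) (\<phi> (coords ?a g)) =
      sesq ?I a1 (shift N e1 f) g + sesq ?I a2 (shift N e2 f) g" for f g
    by (simp add: b_def distrib_right sum.distrib coords1_pairing coords2_pairing)
  have b_arith: "b (\<lambda>x. f x + g x) = (\<lambda>i. b f i + b g i)" "b (\<lambda>x. f x - g x) = (\<lambda>i. b f i - b g i)"
      "b (\<lambda>x. c * f x) = (\<lambda>i. c * b f i)" for f g c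
    by (auto simp: b_def shift_arith coords_add coords_diff coords_scale algebra_simps)
  \<comment> \<open>Here the spanning property enters: being orthogonal to every class, the vector must vanish.\<close>
  have b_null: "b f = (\<lambda>_. 0)" if "supported f" "coords ?a f = (\<lambda>_. 0)" for f
  proof -
    have "matrix_apply ?I ?a f m = 0" if "m \<in> ?I" for m
    proof -
      have "sesq ?I ?a f (u i) = 0" if "i < k" for i
        using fun_cong[OF \<open>coords ?a f = _\<close>, of i] that by (simp add: coords_def)
      then have "sesq ?I ?a f (point_mass m) = 0"
        by (subst expansion) simp
      then show ?thesis
        using that by (simp add: sesq_point_mass_right)
    qed
    then have "matrix_apply ?I a1 (shift N e1 f) m + matrix_apply ?I a2 (shift N e2 f) m = 0"
      if "m \<in> ?I" for m
      using kernel[of f m] that \<open>supported f\<close> by (auto simp: supported_def supp_on_def)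
    then have "sesq ?I a1 (shift N e1 f) g + sesq ?I a2 (shift N e2 f) g = 0" for g
      by (simp add: sesq_eq_sum_matrix_apply flip: sum.distrib distrib_right)
    then have "hinner H (\<phi> (b f)) x = 0" if "x \<in> carrier H" for x
      using that by (auto elim!: carrier_H_coords simp only: hinner_b)
    then have "\<phi> (b f) = \<zero>\<^bsub>H\<^esub>"
      by (intro hinner_definite) (auto simp del: hinner_H)
    then show ?thesis
      using inj by (simp add: zero_H inj_on_eq_iff)
  qed
  define D where "D = {\<phi> (coords ?a f) | f. supported f}"
  \<comment> \<open>Some representative is chosen; by linearity and \<open>b_null\<close> the value does not depend on it.\<close>
  define A where "A x = \<phi> (b (SOME f. supported f \<and> x = \<phi> (coords ?a f)))" for x
  have A: "A (\<phi> (coords ?a f)) = \<phi> (b f)" if "supported f" for f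
  proof -
    define g where "g = (SOME g. supported g \<and> \<phi> (coords ?a f) = \<phi> (coords ?a g))"
    have g: "supported g" "\<phi> (coords ?a f) = \<phi> (coords ?a g)"
      using someI[of "\<lambda>g. supported g \<and> \<phi> (coords ?a f) = \<phi> (coords ?a g)" f] that
      by (auto simp: g_def)
    then have "coords ?a f = coords ?a g"
      using inj by (simp add: inj_on_eq_iff)
    moreover have "supported (\<lambda>x. f x - g x)"
      using that g(1) by (auto simp: supported_def)
    ultimately have "b (\<lambda>x. f x - g x) = (\<lambda>_. 0)"
      by (intro b_null) (auto simp: coords_diff)
    then have "b f = b g"
      by (simp add: b_arith fun_eq_iff)
    then show ?thesis
      by (simp add: A_def g_def)
  qed
  have supported_arith: "supported (\<lambda>_. 0)" "supported f \<Longrightarrow> supported g \<Longrightarrow> supported (\<lambda>x. f x + g x)"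
      "supported f \<Longrightarrow> supported (\<lambda>x. c * f x)" for f g c
    by (auto simp: supported_def)
  have plus: "\<phi> (coords ?a f) \<oplus>\<^bsub>H\<^esub> \<phi> (coords ?a g) = \<phi> (coords ?a (\<lambda>x. f x + g x))" for f g
    by (simp add: coords_add)
  have scale: "c \<odot>\<^bsub>H\<^esub> \<phi> (coords ?a f) = \<phi> (coords ?a (\<lambda>x. c * f x))" for c f
    by (simp add: coords_scale)
  have D_closed: "\<zero>\<^bsub>H\<^esub> \<in> D" "x \<in> D \<Longrightarrow> y \<in> D \<Longrightarrow> x \<oplus>\<^bsub>H\<^esub> y \<in> D" "x \<in> D \<Longrightarrow> c \<odot>\<^bsub>H\<^esub> x \<in> D"
    and D_sub: "D \<subseteq> carrier H" for x y c
  proof -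
    have "\<zero>\<^bsub>H\<^esub> = \<phi> (coords ?a (\<lambda>_. 0))"
      by (simp add: zero_H coords_zero)
    then show "\<zero>\<^bsub>H\<^esub> \<in> D"
      unfolding D_def using supported_arith(1) by blast
    show "x \<oplus>\<^bsub>H\<^esub> y \<in> D" if "x \<in> D" "y \<in> D"
      using that plus supported_arith(2) unfolding D_def by fastforce
    show "c \<odot>\<^bsub>H\<^esub> x \<in> D" if "x \<in> D"
      using that scale supported_arith(3) unfolding D_def by fastforce
  qed (auto simp: D_def)
  have "submodule D (ring_of_type_algebra :: complex ring) H"
  proof (rule submoduleI)
    show "\<ominus>\<^bsub>H\<^esub> x \<in> D" if "x \<in> D" for x
    proof -
      have "x \<in> carrier H"
        using that D_sub by blast
      then have "\<ominus>\<^bsub>H\<^esub> x = (- 1) \<odot>\<^bsub>H\<^esub> x"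
        by (intro M.minus_equality) (auto simp: zero_H elim!: carrier_H_cases)
      then show ?thesis
        using D_closed(3)[OF that] by simp
    qed
  qed (use D_closed D_sub in auto)
  then have "linear_operator_on H D A"
    unfolding linear_operator_on_def D_def
    by (auto simp: A plus scale supported_arith b_arith simp del: add_H smult_H)
      (auto simp: b_arith)
  moreover have "hinner H (A x) y = hinner H x (A y)" if xy: "x \<in> D" "y \<in> D" for x y
  proof -
    obtain f g where fg: "supported f" "x = \<phi> (coords ?a f)" "supported g" "y = \<phi> (coords ?a g)"
      using xy by (auto simp: D_def)
    \<comment> \<open>The form \<open>\<langle>A f, g\<rangle>\<close> on functions that vanish off the smaller index set.\<close>
    define c where "c f g = (\<Sum>m\<in>?I'. \<Sum>n\<in>?I'. (a1 m (n + e1) + a2 m (n + e2)) * f n * cnj (g m))"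
      for f g :: "nat \<times> nat \<Rightarrow> complex"
    have sesq_shift: "sesq ?I a1 (shift N e1 f) g + sesq ?I a2 (shift N e2 f) g = c f g"
      if "supported g" for f g
    proof -
      have restrict: "(\<Sum>m\<in>?I. F m * cnj (g m)) = (\<Sum>m\<in>?I'. F m * cnj (g m))" for F
        using that unfolding supported_def
        by (intro sum.mono_neutral_right) (auto simp: index_set_shift[of _ N])
      show ?thesis
        unfolding sesq_eq_sum_matrix_apply restrict
        by (simp only: matrix_apply_shift c_def sum_distrib_right distrib_right sum.distrib)
    qed
    have "c f g = cnj (c g f)"
    proof -
      have "a1 m (n + e1) + a2 m (n + e2) = cnj (a1 n (m + e1) + a2 n (m + e2))"
        if "m \<in> ?I'" "n \<in> ?I'" for m n
      proof -
        have herm: "a1 x y = cnj (a1 y x)" "a2 x y = cnj (a2 y x)" if "x \<in> ?I" "y \<in> ?I" for x y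
          using that p1.sesq_hermitian[of "point_mass y" "point_mass x"]
            p2.sesq_hermitian[of "point_mass y" "point_mass x"]
          by (simp_all add: sesq_point_mass_right matrix_apply_point_mass)
        show ?thesis
          using Hankel[OF that] herm[of "m + e1" n] herm[of "m + e2" n] that
            herm(1)[of "m + e1" n] herm(2)[of "m + e2" n]
          by (simp add: index_set_shift[of _ N])
      qed
      then have "c f g = (\<Sum>m\<in>?I'. \<Sum>n\<in>?I'. cnj ((a1 n (m + e1) + a2 n (m + e2)) * g m * cnj (f n)))"
        unfolding c_def by (intro sum.cong refl) simp
      also have "\<dots> = cnj (c g f)"
        unfolding c_def cnj_sum by (rule sum.swap)
      finally show ?thesis .
    qed
    moreover have "hinner H (A x) y = c f g"
      using fg by (simp only: A hinner_b sesq_shift)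
    moreover have "hinner H x (A y) = cnj (c g f)"
      using fg hinner_cnj_commute[of "A y" x] by (simp only: A hinner_b sesq_shift \<phi>_closed b_in coords_in)
    ultimately show ?thesis
      by simp
  qed
  ultimately have sym: "symmetric_operator H D A"
    by (simp add: symmetric_operator_def)
  have null1: "coords a1 (point_mass n) = (\<lambda>_. 0)" if "n \<in> ?I" "a1 n n = 0" for n
    using that p1.sesq_null[of "point_mass n"]
    by (auto simp: coords_def sesq_point_mass_right matrix_apply_point_mass)
  have null2: "coords a2 (point_mass n) = (\<lambda>_. 0)" if "n \<in> ?I" "a2 n n = 0" for n
    using that p2.sesq_null[of "point_mass n"]
    by (auto simp: coords_def sesq_point_mass_right matrix_apply_point_mass)
  have "finite_HVMS H N \<alpha> Y D A"
    unfolding finite_HVMS_def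
  proof (intro conjI ballI impI)
    show "Y (\<alpha> (0, l)) = \<zero>\<^bsub>H\<^esub>" if "l \<in> {1..N}" for l
      unfolding \<alpha>_def Y_coords zero_H using that diag1[OF that]
      by (subst null1) (auto simp: index_set_def)
    show "\<alpha> (l, 0) \<ominus>\<^bsub>H\<^esub> Y (\<alpha> (l, 0)) = \<zero>\<^bsub>H\<^esub>" if "l \<in> {1..N}" for l
      unfolding \<alpha>_def complement_Y_coords zero_H using that diag2[OF that]
      by (subst null2) (auto simp: index_set_def)
    fix n assume n: "n \<in> ?I'"
    have supp: "supported (point_mass n)"
      using n by (auto simp: supported_def point_mass_def)
    then show "\<alpha> n \<in> D"
      by (auto simp: D_def \<alpha>_def)
    show "A (\<alpha> n) = Y (\<alpha> (n + e1)) \<oplus>\<^bsub>H\<^esub> (\<alpha> (n + e2) \<ominus>\<^bsub>H\<^esub> Y (\<alpha> (n + e2)))"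
      unfolding \<alpha>_def complement_Y_coords A[OF supp] unfolding Y_coords using n
      by (simp add: b_def[abs_def] shift_point_mass)
  qed (use positive_contraction_Y sym complex_hilbert_space_axioms in \<open>auto simp: \<alpha>_def\<close>)
  moreover have "a1 m n = hinner H (Y (\<alpha> n)) (\<alpha> m) \<and> a2 m n = hinner H (\<alpha> n \<ominus>\<^bsub>H\<^esub> Y (\<alpha> n)) (\<alpha> m)"
    if "m \<in> ?I" "n \<in> ?I" for m n
    unfolding \<alpha>_def complement_Y_coords hinner_coords2 unfolding Y_coords hinner_coords1
    using that by (simp add: sesq_point_mass_right matrix_apply_point_mass)
  ultimately show ?thesis
    unfolding finite_Hankel_pair_def by blast
qed

section \<open>The characterization of finite Hankel pairs\<close>

theorem theorem5p7:
  fixes N :: nat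
    and a1 a2 :: "nat \<times> nat \<Rightarrow> nat \<times> nat \<Rightarrow> complex"
    and \<iota> :: "complex \<Rightarrow> 'h"
  assumes "N \<ge> 1"
    and ambient_type_large: "inj \<iota>"
  shows "finite_Hankel_pair TYPE('h) N a1 a2 \<longleftrightarrow>
    (positive_semidefinite (index_set N) a1 \<and> positive_semidefinite (index_set N) a2) \<and>
    (\<forall>m\<in>index_set (N - 1). \<forall>n\<in>index_set (N - 1).
       a1 (m + e1) n + a2 (m + e2) n = a1 m (n + e1) + a2 m (n + e2)) \<and>
    (\<forall>l\<in>{1..N}. a1 (0, l) (0, l) = 0 \<and> a2 (l, 0) (l, 0) = 0) \<and>
    (\<forall>f :: nat \<times> nat \<Rightarrow> complex.
       supp_on (index_set N) f \<subseteq> index_set (N - 1) \<longrightarrow>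
       (\<forall>m\<in>index_set N. matrix_apply (index_set N) (\<lambda>x y. a1 x y + a2 x y) f m = 0) \<longrightarrow>
       (\<forall>m\<in>index_set N.
          matrix_apply (index_set N) a1 (shift N e1 f) m +
          matrix_apply (index_set N) a2 (shift N e2 f) m = 0))"
    (is "?L \<longleftrightarrow> ?R")
proof
  assume ?L
  then obtain H :: "'h hilbert_record" and \<alpha> Y D A where
    hvms: "finite_HVMS H N \<alpha> Y D A" and
    a: "\<forall>m\<in>index_set N. \<forall>n\<in>index_set N.
      a1 m n = hinner H (Y (\<alpha> n)) (\<alpha> m) \<and> a2 m n = hinner H (\<alpha> n \<ominus>\<^bsub>H\<^esub> Y (\<alpha> n)) (\<alpha> m)"
    unfolding finite_Hankel_pair_def by blast
  have a1: "a1 m n = hinner H (Y (\<alpha> n)) (\<alpha> m)"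
    and a2: "a2 m n = hinner H (\<alpha> n \<ominus>\<^bsub>H\<^esub> Y (\<alpha> n)) (\<alpha> m)"
    if "m \<in> index_set N" "n \<in> index_set N" for m n
    using a that by auto
  note cond = Hankel_pair_conditions[OF hvms a1 a2]
  show ?R
    by (intro conjI ballI allI impI; (rule cond; assumption))
next
  assume R: ?R
  show ?L
    by (rule finite_HVMS_exists[OF ambient_type_large]) (use R in blast)+
qed

end
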